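(* Fix $\lambda \in \mathbb{R}$ with $\lambda \neq 1$ and $\rho > 0$. There exists $\epsilon_0 > 0$ such that the following assertions hold for all $\epsilon \in [0, \epsilon_0]$, all $h > 0$ such that $0 < h \rho^3 < \epsilon$, and any $0 < c < \rho h$. (T1) If $\lambda < 1$, then the section $\Delta^{\mathrm{in}}$ (including the point $\Delta^{\mathrm{in}} \cap S_{a,\epsilon,h}^-$) is mapped by $\Pi_a$ to a set about $S_{a,\epsilon,h}^{+}$ of $y$-width $\mathcal{O}\left((1-c)^{\frac{C\rho}{h\epsilon}}\right)$, where $C$ is a positive constant, such that every point in $\Pi_a(\Delta^{\mathrm{in}})$ is $\mathcal{O}(h\epsilon)$-close to $\Delta_a^{\mathrm{out}}$. (T2) If $\lambda > 1$, then the manifold $S_{a,\epsilon,h}^-$ passes through $\Delta_e^{\mathrm{out}}$ at a point $(\rho, k(\epsilon))$ where $k(\epsilon) = \mathcal{O}(\epsilon^{1/3})$. The section $\Delta^{\mathrm{in}}$ is mapped by $\Pi_e$ to a set about $S_{a,\epsilon,h}^{-}$ of $y$-width $\mathcal{O}\left((1-c)^{\frac{C\rho}{h\epsilon}}\right)$, where $C$ is a positive constant, such that every point in $\Pi_e(\Delta^{\mathrm{in}})$ is $\mathcal{O}(h(\epsilon+\rho^2))$-close to $\Delta_e^{\mathrm{out}}$.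
   Context: Consider the map $P:\mathbb{R}^4\to\mathbb{R}^4$ (explicit Euler discretization with step size $h$ of $x'=x^2-y^2+\lambda\epsilon$, $y'=\epsilon$), $$P:(x,y,\epsilon,h)\mapsto\big(x+h(x^2-y^2+\lambda\epsilon),\; y+\epsilon h,\; \epsilon,\; h\big).$$ Since $\epsilon,h$ are constant under $P$, points are denoted by their $(x,y)$-coordinates and $P^n(x,y)$ abbreviates $P^n(x,y,\epsilon,h)$ for the given fixed $\epsilon,h$. Critical and slow manifolds: the critical manifold is $S_0=\{(x,y,\epsilon,h)\in\mathbb{R}^4: x^2=y^2\}\setminus\{0\}$, which consists of fixed points for $\epsilon=0$. It is normally hyperbolic away from the origin, and splits into attracting branches $S_a^-$ ($x=y<0$), $S_a^+$ ($x=-y$, $y>0$) and repelling branches $S_r^-$ ($x=-y$, $y<0$), $S_r^+$ ($x=y>0$). By standard normal hyperbolicity theory (Hirsch--Pugh--Shub), for small $\epsilon,h>0$ there are corresponding forward invariant slow manifolds $S_{a,\epsilon,h}^{\pm}$, $S_{r,\epsilon,h}^{\pm}$, perturbing from these branches. The statement concerns the extension of $S_{a,\epsilon,h}^-$ past a neighbourhood of the origin under the dynamics of $P$. Sections: for the fixed $\rho>0$ and $J$ a small open interval around $0$ in $\mathbb{R}$, $$\Delta^{\mathrm{in}}=\{(-\rho,y): y+\rho\in J\},\quad \Delta_a^{\mathrm{out}}=\{(-\rho,y): y-\rho\in J\},\quad \Delta_e^{\mathrm{out}}=\{(\rho,y): y\in J\}.$$ Points of $\Delta^{\mathrm{in}}$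 are also denoted just by their $y$-coordinate. Transition maps: for $y\in\Delta^{\mathrm{in}}$, $$\Pi_a(y)=P^{n^*(y)}(-\rho,y),\quad n^*(y)=\operatorname{arg\,min}_{n\in\mathbb{N}}\operatorname{dist}\big(P^n(-\rho,y),\Delta_a^{\mathrm{out}}\big),$$ $$\Pi_e(y)=P^{m^*(y)}(-\rho,y),\quad m^*(y)=\operatorname{arg\,min}_{n\in\mathbb{N}}\operatorname{dist}\big(P^n(-\rho,y),\Delta_e^{\mathrm{out}}\big).$$ The $y$-width of a set is its width in the $y$-direction.
   Formalization: The y-width bound is proved as the vertical distance of each image point from the slow manifold, not as the y-extent of the image, which is at least hε because each step moves y by exactly hε; k may depend on h as well as ε. *)

theory Defs
  imports "HOL-Analysis.Analysis"
begin

text \<open>The explicit Euler map on \<open>\<real>\<^sup>4\<close> for \<open>x' = x\<^sup>2 - y\<^sup>2 + lam * eps\<close>, \<open>y' = eps\<close> with step size \<open>h\<close>.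
  Points are \<open>(x, y, eps, h)\<close>.\<close>

definition euler_map :: "real \<Rightarrow> real \<times> real \<times> real \<times> real \<Rightarrow> real \<times> real \<times> real \<times> real" where
  "euler_map lam = (\<lambda>(x, y, eps, h). (x + h * (x\<^sup>2 - y\<^sup>2 + lam * eps), y + eps * h, eps, h))"

text \<open>\<open>P\<^sup>n(x, y)\<close> for given \<open>eps\<close>, \<open>h\<close>, in \<open>(x, y)\<close>-coordinates.\<close>

definition euler_iter :: "real \<Rightarrow> real \<Rightarrow> real \<Rightarrow> nat \<Rightarrow> real \<times> real \<Rightarrow> real \<times> real" where
  "euler_iter lam eps h n =
     (\<lambda>(x, y). case (euler_map lam ^^ n) (x, y, eps, h) of (x', y', _, _) \<Rightarrow> (x', y'))"

text \<open>The attracting branches of the critical manifold \<open>x\<^sup>2 = y\<^sup>2\<close>, in \<open>(x, y)\<close>-coordinates.\<close>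

definition attracting_branch_minus :: "(real \<times> real) set" where
  "attracting_branch_minus = {(x, y). x = y \<and> y < 0}"

definition attracting_branch_plus :: "(real \<times> real) set" where
  "attracting_branch_plus = {(x, y). x = - y \<and> y > 0}"

text \<open>Slow manifolds are not unique, so being one is a property of a family \<open>S eps h\<close> of curves.
  Over the compact \<open>y\<close>-interval \<open>I\<close> on which the branch \<open>B\<close> is the graph \<open>x = g y\<close>, the curve
  \<open>S eps h\<close> is, for all small \<open>eps, h > 0\<close>, a \<open>C\<^sup>1\<close> graph \<open>x = \<phi> y\<close> that is \<open>O(eps)\<close>-close to
  \<open>B\<close> in the \<open>C\<^sup>1\<close> sense.  As \<open>y\<close> increases under the map, forward invariance holds up to
  leaving through the end of \<open>I\<close>.\<close>

definition slow_manifold ::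
  "real \<Rightarrow> (real \<times> real) set \<Rightarrow> real set \<Rightarrow> (real \<Rightarrow> real \<Rightarrow> (real \<times> real) set) \<Rightarrow> bool" where
  "slow_manifold lam B I S \<longleftrightarrow>
     (\<exists>g g'.
        (\<forall>y\<in>I. (g y, y) \<in> B \<and> (g has_real_derivative g' y) (at y within I)) \<and>
        (\<exists>eps1>0. \<exists>h1>0. \<exists>K. \<forall>eps h. 0 < eps \<and> eps \<le> eps1 \<and> 0 < h \<and> h \<le> h1 \<longrightarrow>
           (\<forall>p\<in>S eps h. snd (euler_iter lam eps h 1 p) \<in> I \<longrightarrow> euler_iter lam eps h 1 p \<in> S eps h) \<and>
           (\<exists>\<phi> \<phi>'. S eps h = (\<lambda>y. (\<phi> y, y)) ` I \<and> continuous_on I \<phi>' \<and>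
              (\<forall>y\<in>I. (\<phi> has_real_derivative \<phi>' y) (at y within I) \<and>
                     \<bar>\<phi> y - g y\<bar> \<le> K * eps \<and> \<bar>\<phi>' y - g' y\<bar> \<le> K * eps))))"

text \<open>The extension of a set under the dynamics.\<close>

definition forward_extension :: "real \<Rightarrow> real \<Rightarrow> real \<Rightarrow> (real \<times> real) set \<Rightarrow> (real \<times> real) set" where
  "forward_extension lam eps h A = (\<Union>n. euler_iter lam eps h n ` A)"

definition Delta_in :: "real \<Rightarrow> real set \<Rightarrow> (real \<times> real) set" where
  "Delta_in rho J = {(x, y). x = - rho \<and> y + rho \<in> J}"

definition Delta_a_out :: "real \<Rightarrow> real set \<Rightarrow> (real \<times> real) set" where
  "Delta_a_out rho J = {(x, y). x = - rho \<and> y - rho \<in> J}"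

definition Delta_e_out :: "real \<Rightarrow> real set \<Rightarrow> (real \<times> real) set" where
  "Delta_e_out rho J = {(x, y). x = rho \<and> y \<in> J}"

text \<open>The orbit point closest to the section \<open>D\<close>; ties are broken by the choice made in
  \<open>arg_min\<close>.\<close>

definition transition_map ::
  "real \<Rightarrow> real \<Rightarrow> real \<Rightarrow> (real \<times> real) set \<Rightarrow> real \<times> real \<Rightarrow> real \<times> real" where
  "transition_map lam eps h D p =
     euler_iter lam eps h (arg_min (\<lambda>n. infdist (euler_iter lam eps h n p) D) (\<lambda>n. True)) p"

definition Pi_a :: "real \<Rightarrow> real \<Rightarrow> real \<Rightarrow> real \<Rightarrow> real set \<Rightarrow> real \<times> real \<Rightarrow> real \<times> real" where
  "Pi_a lam eps h rho J = transition_map lam eps h (Delta_a_out rho J)"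

definition Pi_e :: "real \<Rightarrow> real \<Rightarrow> real \<Rightarrow> real \<Rightarrow> real set \<Rightarrow> real \<times> real \<Rightarrow> real \<times> real" where
  "Pi_e lam eps h rho J = transition_map lam eps h (Delta_e_out rho J)"

text \<open>\<open>A\<close> is a set about the curve \<open>S\<close> of \<open>y\<close>-width at most \<open>w\<close> on either side: it lies in the
  strip around \<open>S\<close> whose extent in the \<open>y\<close>-direction, measured from \<open>S\<close>, is \<open>w\<close>.  This is not the
  diameter of the projection of \<open>A\<close> to the \<open>y\<close>-axis: the images of the entry section under the
  transition maps spread along \<open>S\<close> over a \<open>y\<close>-range of order \<open>h * eps\<close>, since every step of the
  map advances \<open>y\<close> by exactly \<open>h * eps\<close>.\<close>

definition set_about_of_y_width :: "(real \<times> real) set \<Rightarrow> (real \<times> real) set \<Rightarrow> real \<Rightarrow> bool" where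
  "set_about_of_y_width A S w \<longleftrightarrow> (\<forall>(x, y)\<in>A. \<exists>y'. (x, y') \<in> S \<and> \<bar>y - y'\<bar> \<le> w)"

end

theory Submission
  imports Defs "HOL-Real_Asymp.Real_Asymp"
begin

text \<open>Let \<open>d = x - y\<close> and \<open>s = x + y\<close>. One step of the map gives
  \<open>d' = d (1 + h s) + h (lam - 1) eps\<close> and \<open>s' = s (1 + h d) + h (lam + 1) eps\<close>, and the
  horizontal distance \<open>u\<close> of two orbits at the same height satisfies
  \<open>u' = u (1 + h (x\<^sub>1 + x\<^sub>2))\<close>. While \<open>s\<close> is negative, the first equation drives \<open>d\<close> to the sign
  of \<open>lam - 1\<close>.

  If \<open>lam < 1\<close>, then \<open>d \<le> - b y\<close> for \<open>y \<ge> 0\<close> with a constant \<open>b > 0\<close>, so the equation for \<open>s\<close>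
  contracts, the orbit is \<open>O(eps)\<close>-close to \<open>x = - y\<close>, and \<open>u\<close>, measured against the slow
  manifold there, decays like \<open>exp (- const / eps)\<close>.

  If \<open>lam > 1\<close>, then for \<open>y \<ge> 0\<close> the distance \<open>d\<close> grows at least like the solution of
  \<open>d' = d\<^sup>2 + (lam - 1) eps\<close>, which blows up within a range of heights \<open>O(sqrt eps)\<close>. On this short
  range \<open>u\<close> grows by at most \<open>exp (O(1 / sqrt eps))\<close>, which does not spoil the contraction
  \<open>exp (- const / eps)\<close> collected along \<open>x = y < 0\<close>. Horizontal distances bound vertical ones
  because the extended slow manifold has slope at least 1 (as a graph over \<open>y\<close>) near the exit.

  All contraction rates are of the form \<open>exp (- kappa / eps)\<close>, and
  \<open>(1 - c) powr (C * rho / (h * eps)) \<ge> exp (- 2 * C * rho\<^sup>2 / eps)\<close> because \<open>c < rho * h\<close>.\<close>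

section \<open>Orbits of the Euler map\<close>

text \<open>Stated for sequences rather than iterates, so that tails of an orbit are again orbits
  (\<open>shift\<close>) and two orbits can share one height sequence \<open>y\<close>.\<close>

locale euler_orbit =
  fixes lam eps h :: real and x y :: "nat \<Rightarrow> real"
  assumes eps_pos: "0 < eps" and h_pos: "0 < h"
    and x_Suc: "x (Suc n) = x n + h * ((x n)\<^sup>2 - (y n)\<^sup>2 + lam * eps)"
    and y_Suc: "y (Suc n) = y n + eps * h"
begin

lemma step_pos: "0 < eps * h"
  using eps_pos h_pos by simp

lemma y_eq: "y (m + n) = y m + real n * (eps * h)"
  by (induction n) (auto simp: y_Suc algebra_simps)

lemma y_diff: "m \<le> n \<Longrightarrow> y n - y m = real (n - m) * (eps * h)"
  using y_eq[of m "n - m"] by simp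

lemma y_mono: "m \<le> n \<Longrightarrow> y m \<le> y n"
  using y_diff[of m n] step_pos by (smt (verit) mult_nonneg_nonneg of_nat_0_le_iff)

lemma y_less_iff: "y m < y n \<longleftrightarrow> m < n"
proof
  show "m < n" if "y m < y n"
    using that y_mono[of n m] by (meson not_le)
  show "y m < y n" if "m < n"
    using that y_diff[of m n] step_pos by (smt (verit) less_imp_le mult_pos_pos of_nat_0_less_iff zero_less_diff)
qed

lemma time_eq: "m \<le> n \<Longrightarrow> h * real (n - m) = (y n - y m) / eps"
  using y_diff[of m n] eps_pos by (simp add: field_simps)

lemma unbounded: obtains n where "t < y n"
proof -
  obtain n where "(t - y 0) / (eps * h) < real n"
    using reals_Archimedean2 by blast
  then have "t < y n"
    using y_eq[of 0 n] step_pos by (simp add: divide_less_eq)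
  then show ?thesis
    using that by blast
qed

text \<open>Heights advance by exactly \<open>eps * h\<close>, so the least index at or above
  \<open>t\<close> overshoots by less than one step. These indices cut an orbit into stages by
  height.\<close>

lemma first_passage:
  assumes "y 0 < t"
  obtains m where "0 < m" "t \<le> y m" "y m < t + eps * h" "\<And>k. k < m \<Longrightarrow> y k < t"
proof -
  define m where "m = (LEAST n. t \<le> y n)"
  have ex: "\<exists>n. t \<le> y n"
    using unbounded[of t] by (metis less_imp_le)
  have m: "t \<le> y m"
    unfolding m_def using LeastI_ex[OF ex] .
  have k: "y k < t" if "k < m" for k
    using not_less_Least[of k] that unfolding m_def by fastforce
  obtain m' where m': "m = Suc m'"
    using m assms by (cases m) auto
  show ?thesis
    using that[of m] m k k[of m'] m' y_Suc[of m'] by auto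
qed

lemma shift: "euler_orbit lam eps h (\<lambda>n. x (m + n)) (\<lambda>n. y (m + n))"
  by unfold_locales (auto simp: eps_pos h_pos x_Suc y_Suc)

lemma diff_step:
  "x (Suc n) - y (Suc n) = (x n - y n) * (1 + h * (x n + y n)) + h * (lam - 1) * eps"
  by (simp add: x_Suc y_Suc algebra_simps power2_eq_square)

lemma sum_step:
  "x (Suc n) + y (Suc n) = (x n + y n) * (1 + h * (x n - y n)) + h * (lam + 1) * eps"
  by (simp add: x_Suc y_Suc algebra_simps power2_eq_square)

text \<open>At \<open>x = - M\<close> the vector field is
  \<open>M\<^sup>2 - y\<^sup>2 + lam * eps\<close>, which is nonnegative. A step cannot jump over
  the line, because the difference to the line factors as \<open>(x + M) * (1 + h * (x - M))\<close>
  and the second factor is nonnegative for small \<open>h\<close>.\<close>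

lemma lower_barrier:
  assumes "0 \<le> M" "2 * h * M \<le> 1" "- M \<le> x 0"
    and "\<And>k. k < n \<Longrightarrow> (y k)\<^sup>2 \<le> M\<^sup>2 + lam * eps"
  shows "- M \<le> x n"
  using assms(4)
proof (induction n)
  case 0
  show ?case using assms by simp
next
  case (Suc n)
  have IH: "- M \<le> x n" using Suc by simp
  have "h * (x n - M) \<ge> h * (- 2 * M)"
    using IH h_pos by (intro mult_left_mono) auto
  then have "0 \<le> (x n + M) * (1 + h * (x n - M))"
    using IH assms(2) by (intro mult_nonneg_nonneg) auto
  then have "- M + h * M\<^sup>2 \<le> x n + h * (x n)\<^sup>2"
    by (simp add: algebra_simps power2_eq_square)
  moreover have "0 \<le> h * (M\<^sup>2 - (y n)\<^sup>2 + lam * eps)"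
    using Suc.prems[of n] h_pos by simp
  ultimately show ?case
    by (simp add: x_Suc algebra_simps)
qed

text \<open>On the ray \<open>x = y / 2\<close> the field is
  \<open>lam * eps - 3 * y\<^sup>2 / 4\<close>, nonpositive below height \<open>- z\<close>, while
  the ray itself moves to the right as \<open>y\<close> grows. The same factorisation as for a
  vertical barrier excludes jumping over it.\<close>

lemma upper_barrier:
  assumes "x 0 \<le> y 0 / 2" "0 \<le> z" "4 * lam * eps \<le> 3 * z\<^sup>2" "y n \<le> - z"
    and "\<And>k. k < n \<Longrightarrow> h * (x k + y k / 2) \<ge> - 1"
  shows "x n \<le> y n / 2"
  using assms(4,5)
proof (induction n)
  case 0
  show ?case using assms by simp
next
  case (Suc n)
  have yn: "y n \<le> - z"
    using Suc.prems(1) step_pos by (simp add: y_Suc)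
  have IH: "x n \<le> y n / 2" using Suc yn by simp
  have "0 \<le> (y n / 2 - x n) * (1 + h * (x n + y n / 2))"
    using IH Suc.prems(2)[of n] by (intro mult_nonneg_nonneg) auto
  then have "x n + h * (x n)\<^sup>2 \<le> y n / 2 + h * (y n)\<^sup>2 / 4"
    by (simp add: algebra_simps power2_eq_square)
  moreover have "z\<^sup>2 \<le> (y n)\<^sup>2"
    using yn assms(2) by (metis abs_le_square_iff abs_of_nonneg abs_of_nonpos le_minus_iff neg_le_0_iff_le order_trans)
  then have "h * (lam * eps) \<le> h * (3 * (y n)\<^sup>2 / 4)"
    using assms(3) h_pos by (intro mult_left_mono) auto
  moreover have "0 < eps * h" using step_pos .
  ultimately show ?case
    by (simp add: x_Suc y_Suc algebra_simps)
qed

text \<open>Adding \<open>a\<close> to \<open>x - y\<close> turns the growth law \<open>d\<^sup>2 + a\<^sup>2\<close> into \<open>z\<^sup>2 / 2\<close>, whose reciprocal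
  drops by a fixed amount in each step.\<close>

lemma blow_up:
  assumes "0 < a" "a\<^sup>2 = (lam - 1) * eps" "0 \<le> x 0 - y 0" "0 \<le> y 0"
    and R: "0 \<le> R" "h * (R + a) \<le> 2"
    and n: "4 * eps / a \<le> y n - y 0"
  shows "R \<le> x n - y n"
proof -
  define d where "d k = x k - y k" for k
  have step: "d k + h * (d k)\<^sup>2 + h * a\<^sup>2 \<le> d (Suc k)" if "0 \<le> d k" for k
  proof -
    have "y 0 \<le> y k" using y_mono[of 0 k] by simp
    then have "0 \<le> h * (d k * (2 * y k))"
      using that h_pos assms(4) by simp
    moreover have "d (Suc k) = d k * (1 + h * (d k + 2 * y k)) + h * a\<^sup>2"
      using diff_step[of k] unfolding d_def by (simp add: assms(2) mult.assoc)
    then have "d (Suc k) = d k + h * (d k)\<^sup>2 + h * (d k * (2 * y k)) + h * a\<^sup>2"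
      by (simp add: algebra_simps power2_eq_square)
    ultimately show ?thesis by simp
  qed
  have d_nonneg: "0 \<le> d k" for k
  proof (induction k)
    case 0
    show ?case using assms by (simp add: d_def)
  next
    case (Suc k)
    then show ?case using step[of k] h_pos by (smt (verit) mult_nonneg_nonneg zero_le_power2)
  qed
  have grow: "(d k + a) + h * (d k + a)\<^sup>2 / 2 \<le> d (Suc k) + a" for k
  proof -
    have "(d k + a)\<^sup>2 \<le> 2 * ((d k)\<^sup>2 + a\<^sup>2)"
      using zero_le_power2[of "d k - a"] by (simp add: power2_eq_square algebra_simps)
    then have "h * (d k + a)\<^sup>2 \<le> h * (2 * ((d k)\<^sup>2 + a\<^sup>2))"
      using h_pos by simp
    then show ?thesis using step[OF d_nonneg, of k] by (simp add: algebra_simps)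
  qed
  \<comment> \<open>Each step lowers the reciprocal by \<open>h / 4\<close> as long as
    \<open>h * z \<le> 2\<close>, which is guaranteed only below the target \<open>R + a\<close>;
    once the target is reached, growth keeps it.\<close>
  have "R + a \<le> d k + a \<or> 1 / (d k + a) \<le> 1 / a - real k * (h / 4)" for k
  proof (induction k)
    case 0
    show ?case using assms by (simp add: d_def frac_le)
  next
    case (Suc k)
    define z where "z = d k + a"
    have z: "0 < z" using d_nonneg[of k] assms(1) by (simp add: z_def)
    have g: "z * (1 + h * z / 2) \<le> d (Suc k) + a"
      using grow[of k] by (simp add: z_def algebra_simps power2_eq_square)
    show ?case
    proof (cases "R + a \<le> z")
      case True
      have "z \<le> z * (1 + h * z / 2)"
        using z h_pos by simp
      then show ?thesis using g True by linarith
    next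
      case False
      then have IH: "1 / z \<le> 1 / a - real k * (h / 4)"
        using Suc by (simp add: z_def)
      have hz: "h * z \<le> 2"
        using False R(2) h_pos by (smt (verit) mult_left_mono)
      have "1 / (d (Suc k) + a) \<le> 1 / (z * (1 + h * z / 2))"
        using g z h_pos by (intro divide_left_mono) (auto intro!: mult_pos_pos add_pos_pos order_less_le_trans[OF _ g])
      also have "\<dots> = 1 / z - (h / 2) / (1 + h * z / 2)"
        using z h_pos add_pos_pos[of 1 "h * z / 2"] by (simp add: field_simps)
      also have "\<dots> \<le> 1 / z - (h / 2) / 2"
        using hz z h_pos by (intro diff_left_mono divide_left_mono) (auto intro!: mult_pos_pos add_pos_pos)
      finally show ?thesis using IH by (simp add: algebra_simps add_divide_distrib)
    qed
  qed
  \<comment> \<open>A height gain of \<open>4 * eps / a\<close> amounts to a time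
    \<open>h * n\<close> of at least \<open>4 / a\<close>. A positive reciprocal cannot be below the
    resulting nonpositive bound, so the target has been reached.\<close>
  moreover have "1 / a \<le> real n * (h / 4)"
    using n y_diff[of 0 n] eps_pos assms(1) by (simp add: field_simps)
  moreover have "0 < d n + a" using d_nonneg[of n] assms(1) by simp
  ultimately have "R + a \<le> d n + a"
    by (smt (verit) divide_pos_pos)
  then show ?thesis by (simp add: d_def)
qed

end

text \<open>Uses \<open>1 + q \<le> exp q\<close>, valid for either sign of \<open>q\<close>, and
  thus serves mainly for contraction with negative \<open>q\<close>.\<close>

lemma geometric_bound:
  fixes v :: "nat \<Rightarrow> real"
  assumes "\<And>i. i < n \<Longrightarrow> v (Suc i) \<le> (1 + q) * v i" "\<And>i. i \<le> n \<Longrightarrow> 0 \<le> v i"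
  shows "v n \<le> exp (q * real n) * v 0"
  using assms
proof (induction n)
  case (Suc n)
  have "v (Suc n) \<le> (1 + q) * v n" using Suc.prems by simp
  also have "\<dots> \<le> exp q * v n" using Suc.prems(2)[of n] by (intro mult_right_mono exp_ge_add_one_self) auto
  also have "\<dots> \<le> exp q * (exp (q * real n) * v 0)"
    using Suc by (intro mult_left_mono) auto
  also have "\<dots> = exp (q * real (Suc n)) * v 0"
    by (simp add: exp_add algebra_simps)
  finally show ?case .
qed auto

section \<open>Coordinates of the iterates as orbit sequences\<close>

lemma euler_iter_0 [simp]: "euler_iter lam eps h 0 p = p"
  by (cases p) (simp add: euler_iter_def)

lemma euler_iter_Suc:
  "euler_iter lam eps h (Suc n) p = euler_iter lam eps h 1 (euler_iter lam eps h n p)"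
proof -
  obtain x y where p: "p = (x, y)" by force
  have "\<exists>a b. (euler_map lam ^^ n) (x, y, eps, h) = (a, b, eps, h)"
    by (induction n) (auto simp: euler_map_def)
  then obtain a b where "(euler_map lam ^^ n) (x, y, eps, h) = (a, b, eps, h)" by blast
  then show ?thesis
    by (simp add: p euler_iter_def)
qed

lemma euler_iter_1:
  "euler_iter lam eps h 1 (x, y) = (x + h * (x\<^sup>2 - y\<^sup>2 + lam * eps), y + eps * h)"
  by (simp add: euler_iter_def euler_map_def)

lemma euler_iter_add:
  "euler_iter lam eps h (m + n) p = euler_iter lam eps h m (euler_iter lam eps h n p)"
proof (induction m)
  case (Suc m)
  show ?case
    unfolding add_Suc euler_iter_Suc[of _ _ _ "m + n"] Suc euler_iter_Suc[of _ _ _ m] ..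
qed simp

lemma fst_euler_iter_Suc:
  "fst (euler_iter lam eps h (Suc n) p) = fst (euler_iter lam eps h n p) +
    h * ((fst (euler_iter lam eps h n p))\<^sup>2 - (snd (euler_iter lam eps h n p))\<^sup>2 + lam * eps)"
  by (subst euler_iter_Suc, cases "euler_iter lam eps h n p") (simp only: euler_iter_1 fst_conv snd_conv)

lemma snd_euler_iter: "snd (euler_iter lam eps h n p) = snd p + real n * (eps * h)"
proof (induction n)
  case (Suc n)
  then show ?case
    by (subst euler_iter_Suc, cases "euler_iter lam eps h n p")
      (simp only: euler_iter_1 fst_conv snd_conv, simp add: algebra_simps)
qed simp

lemma euler_orbit_iter:
  assumes "0 < eps" "0 < h"
  shows "euler_orbit lam eps h (\<lambda>n. fst (euler_iter lam eps h n p)) (\<lambda>n. snd (euler_iter lam eps h n p))"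
  using assms by unfold_locales (simp_all add: fst_euler_iter_Suc snd_euler_iter algebra_simps)

section \<open>Orbits entering along the attracting branch\<close>

text \<open>The entry box is wide enough for two kinds of starting points: those of the section
  (heights within \<open>rho / 4\<close> of \<open>- rho\<close>) and those of the slow manifold
  below height \<open>- al\<close>.\<close>

locale entering_orbit = euler_orbit +
  fixes rho al :: real
  assumes al: "0 < al" "al \<le> rho / 2"
    and entry: "- 5 / 4 * rho \<le> y 0" "y 0 \<le> - al" "- 3 * rho \<le> x 0" "x 0 \<le> y 0 / 2"
    and h_small: "20 * h * rho \<le> 1"
    and lam_small: "\<bar>lam\<bar> * eps \<le> rho\<^sup>2"
begin

lemma rho_pos: "0 < rho"
  using al by simp

lemma h_mult_le: "k \<le> 20 \<Longrightarrow> h * (k * rho) \<le> k / 20" if "0 \<le> k"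
  using mult_right_mono[OF h_small, of "k / 20"] that by (simp add: algebra_simps)

lemma y_ge: "- 5 / 4 * rho \<le> y n"
  using y_mono[of 0 n] entry by simp

text \<open>The barrier \<open>x = - 3 * rho\<close> works up to height \<open>5 / 2 * rho\<close>
  since \<open>(5 / 2)\<^sup>2 \<le> 3\<^sup>2 - 1\<close>, the \<open>1\<close> absorbing
  \<open>lam * eps\<close>.\<close>

lemma x_ge:
  assumes "y n \<le> 5 / 2 * rho"
  shows "- 3 * rho \<le> x n"
proof -
  have "- (3 * rho) \<le> x n"
  proof (rule lower_barrier)
    show "(y k)\<^sup>2 \<le> (3 * rho)\<^sup>2 + lam * eps" if "k < n" for k
    proof -
      have "\<bar>y k\<bar> \<le> 5 / 2 * rho"
        using y_ge[of k] y_mono[of k n] assms that rho_pos by (auto simp: abs_le_iff)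
      then have "(y k)\<^sup>2 \<le> (5 / 2 * rho)\<^sup>2"
        using power_mono[of "\<bar>y k\<bar>" "5 / 2 * rho" 2] by simp
      moreover have "- rho\<^sup>2 \<le> lam * eps"
        using lam_small eps_pos abs_mult[of lam eps] abs_ge_minus_self[of "lam * eps"] by linarith
      ultimately show ?thesis
        using zero_le_power2[of rho] unfolding power_mult_distrib power_divide by (simp only: power2_eq_square)
    qed
  qed (use rho_pos entry h_small h_pos in \<open>auto simp: algebra_simps\<close>)
  then show ?thesis by simp
qed

lemma x_le:
  assumes "0 \<le> z" "4 * lam * eps \<le> 3 * z\<^sup>2" "y n \<le> - z"
  shows "x n \<le> y n / 2"
proof (rule upper_barrier[OF entry(4) assms])
  show "- 1 \<le> h * (x k + y k / 2)" if "k < n" for k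
  proof -
    have "y k \<le> 5 / 2 * rho"
      using y_mono[of k n] that assms rho_pos by auto
    then have "- (4 * rho) \<le> x k + y k / 2"
      using x_ge[of k] y_ge[of k] rho_pos by simp
    then have "h * (- (4 * rho)) \<le> h * (x k + y k / 2)"
      using h_pos by (intro mult_left_mono) auto
    then show ?thesis using h_mult_le[of 4] by simp
  qed
qed

lemma sum_factor_ge:
  assumes "y n \<le> 5 / 2 * rho"
  shows "- 5 * rho \<le> x n + y n" "1 / 2 \<le> 1 + h * (x n + y n)"
proof -
  show 1: "- 5 * rho \<le> x n + y n"
    using x_ge[OF assms] y_ge[of n] rho_pos by simp
  then have "h * (- 5 * rho) \<le> h * (x n + y n)"
    using h_pos by (intro mult_left_mono) auto
  then show "1 / 2 \<le> 1 + h * (x n + y n)" using h_mult_le[of 5] by simp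
qed

text \<open>The factor \<open>sgn (lam - 1)\<close> treats both signs at once. The source term
  \<open>h * eps * \<bar>lam - 1\<bar>\<close> outweighs the loss at level \<open>c * eps\<close>,
  because \<open>x + y\<close> is at least \<open>- 5 * rho\<close>; so the deficit below that level
  obeys the homogeneous recursion.\<close>

lemma signed_diff_step:
  assumes "0 \<le> c" "5 * rho * c \<le> \<bar>lam - 1\<bar>" "y n \<le> 5 / 2 * rho"
  shows "c * eps - sgn (lam - 1) * (x (Suc n) - y (Suc n))
      \<le> (1 + h * (x n + y n)) * (c * eps - sgn (lam - 1) * (x n - y n))"
proof -
  have "- 5 * rho * c \<le> (x n + y n) * c"
    using sum_factor_ge(1)[OF assms(3)] assms(1) by (rule mult_right_mono)
  then have "0 \<le> (x n + y n) * c + \<bar>lam - 1\<bar>"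
    using assms by simp
  then have "0 \<le> h * eps * ((x n + y n) * c + \<bar>lam - 1\<bar>)"
    using h_pos eps_pos by simp
  moreover have "sgn (lam - 1) * (h * (lam - 1) * eps) = h * eps * \<bar>lam - 1\<bar>"
    by (simp add: abs_sgn)
  ultimately show ?thesis
    unfolding diff_step by (simp add: algebra_simps)
qed

text \<open>Before height \<open>- al / 2\<close> the ray barrier gives
  \<open>x + y \<le> - 3 * al / 4\<close>, so the deficit decays at this rate over a time at least
  \<open>al / (2 * eps)\<close>. This forgets the initial sign of \<open>x - y\<close> up to half of
  the level \<open>c * eps\<close>.\<close>

lemma signed_diff_ge:
  assumes c: "0 \<le> c" "5 * rho * c \<le> \<bar>lam - 1\<bar>"
    and small: "exp (- (3 * al\<^sup>2 / (8 * eps))) * (c * eps + 5 * rho) \<le> c * eps / 2" "16 * lam * eps \<le> 3 * al\<^sup>2"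
    and y: "- al / 2 \<le> y n" "y n \<le> 5 / 2 * rho"
  shows "c * eps / 2 \<le> sgn (lam - 1) * (x n - y n)"
proof -
  have below: "y 0 < - al / 2" using entry al by simp
  obtain m where m: "- al / 2 \<le> y m" "\<And>k. k < m \<Longrightarrow> y k < - al / 2"
    using first_passage[of "- al / 2"] below by metis
  have mn: "m \<le> n"
    using m(2)[of n] y(1) by (meson not_le)
  \<comment> \<open>Truncation at 0 supplies the nonnegativity that the geometric estimate
    requires.\<close>
  define v where "v k = max 0 (c * eps - sgn (lam - 1) * (x k - y k))" for k
  have "v m \<le> exp (- (3 * al / 4 * h) * real m) * v 0"
  proof (rule geometric_bound)
    fix k assume k: "k < m"
    then have yk: "y k \<le> - (al / 2)" using m(2)[of k] by simp
    then have yk': "y k \<le> 5 / 2 * rho" using al rho_pos by simp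
    have "x k \<le> y k / 2"
      using x_le[of "al / 2" k] small(2) al yk by (simp add: power_divide)
    then have "h * (x k + y k) \<le> h * - (3 * al / 4)"
      using yk h_pos by (intro mult_left_mono) auto
    then have "(1 + h * (x k + y k)) * v k \<le> (1 + - (3 * al / 4 * h)) * v k"
      by (intro mult_right_mono) (auto simp: v_def algebra_simps)
    moreover have "v (Suc k) \<le> (1 + h * (x k + y k)) * v k"
    proof -
      have f: "0 \<le> 1 + h * (x k + y k)" using sum_factor_ge(2)[OF yk'] by simp
      have "(1 + h * (x k + y k)) * (c * eps - sgn (lam - 1) * (x k - y k)) \<le> (1 + h * (x k + y k)) * v k"
        using f by (intro mult_left_mono) (auto simp: v_def)
      moreover have "0 \<le> (1 + h * (x k + y k)) * v k" using f by (simp add: v_def)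
      ultimately show ?thesis
        using signed_diff_step[OF c yk'] by (simp add: v_def)
    qed
    ultimately show "v (Suc k) \<le> (1 + - (3 * al / 4 * h)) * v k" by simp
  qed (simp add: v_def)
  also have "\<dots> \<le> exp (- (3 * al\<^sup>2 / (8 * eps))) * (c * eps + 5 * rho)"
  proof (intro mult_mono)
    have "al / (2 * eps) \<le> h * real m"
      using time_eq[of 0 m] m(1) entry eps_pos by (simp add: field_simps)
    then have "3 * al / 4 * (al / (2 * eps)) \<le> 3 * al / 4 * (h * real m)"
      using al by (intro mult_left_mono) auto
    then show "exp (- (3 * al / 4 * h) * real m) \<le> exp (- (3 * al\<^sup>2 / (8 * eps)))"
      by (simp add: power2_eq_square algebra_simps)
    have "\<bar>x 0 - y 0\<bar> \<le> 5 * rho" using entry al by (simp add: abs_le_iff)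
    then have "- (sgn (lam - 1) * (x 0 - y 0)) \<le> 5 * rho"
      by (auto simp: sgn_if abs_le_iff)
    then show "v 0 \<le> c * eps + 5 * rho"
      using c eps_pos rho_pos by (simp add: v_def)
  qed (auto simp: v_def)
  finally have "v m \<le> c * eps / 2" using small(1) by simp
  moreover have "c * eps - sgn (lam - 1) * (x m - y m) \<le> v m"
    by (simp add: v_def)
  \<comment> \<open>From here on contraction is no longer available. The halved level persists
    merely because the factor \<open>1 + h * (x + y)\<close> is nonnegative.\<close>
  ultimately have *: "c / 2 * eps - sgn (lam - 1) * (x m - y m) \<le> 0"
    by simp
  have "c / 2 * eps - sgn (lam - 1) * (x n - y n) \<le> 0"
    using mn y(2)
  proof (induction n rule: dec_induct)
    case base
    then show ?case using * by simp
  next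
    case (step k)
    then have yk: "y k \<le> 5 / 2 * rho" using y_mono[of k "Suc k"] by simp
    have "(1 + h * (x k + y k)) * (c / 2 * eps - sgn (lam - 1) * (x k - y k)) \<le> 0"
      using step yk sum_factor_ge(2)[OF yk] by (intro mult_nonneg_nonpos) auto
    moreover have "5 * rho * (c / 2) \<le> \<bar>lam - 1\<bar>" using c abs_ge_zero[of "lam - 1"] by linarith
    ultimately show ?case using signed_diff_step[of "c / 2" k] c yk by simp
  qed
  then show ?thesis by simp
qed

text \<open>For \<open>e = y - x\<close> the flow has
  \<open>e' = e * (2 * y - e) + (1 - lam) * eps\<close>. On the ray \<open>e = b * y\<close> this is
  at least \<open>b * eps\<close>, the speed of the ray, so the ray is not crossed. At the first
  height above 0 the separation \<open>c * eps\<close> already exceeds \<open>b * y\<close>.\<close>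

lemma left_of_ray:
  assumes sep: "\<And>n. - al / 2 \<le> y n \<Longrightarrow> y n \<le> 5 / 2 * rho \<Longrightarrow> c * eps \<le> y n - x n"
    and b: "0 < b" "b \<le> 1 - lam" "b \<le> 1" "b * h \<le> c"
    and y: "0 \<le> y n" "y n \<le> 5 / 2 * rho"
  shows "b * y n \<le> y n - x n"
proof -
  obtain m where m: "0 \<le> y m" "y m < eps * h" "\<And>k. k < m \<Longrightarrow> y k < 0"
    using first_passage[of 0] entry al by (metis add_0 neg_less_0_iff_less order_le_less_trans)
  have mn: "m \<le> n"
    using m(3)[of n] y(1) by (meson not_le)
  show ?thesis
    using mn y(2)
  proof (induction n rule: dec_induct)
    case base
    have "b * y m \<le> b * (eps * h)" using m b by (intro mult_left_mono) auto
    also have "\<dots> = b * h * eps" by simp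
    also have "\<dots> \<le> c * eps" using b(4) eps_pos by (intro mult_right_mono) auto
    also have "\<dots> \<le> y m - x m" using sep[of m] m(1) base al by simp
    finally show ?case .
  next
    case (step k)
    define e where "e = y k - x k"
    have yk: "0 \<le> y k" "y k \<le> 5 / 2 * rho"
      using step y_mono[of k "Suc k"] y_mono[of m k] m(1) by auto
    have e: "b * y k \<le> e" using step yk by (simp add: e_def)
    have "b * y k \<le> y k" using b yk by (simp add: mult_left_le_one_le)
    \<comment> \<open>The factor \<open>1 - h * (e + b * y - 2 * y)\<close> arises when the step of
      \<open>e\<close> is compared with that of \<open>b * y\<close>; its sign makes the comparison
      monotone.\<close>
    then have "h * (e + b * y k - 2 * y k) \<le> h * (20 * rho)"
      using x_ge[OF yk(2)] yk rho_pos h_pos by (intro mult_left_mono) (auto simp: e_def)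
    then have "0 \<le> (e - b * y k) * (1 - h * (e + b * y k - 2 * y k))"
      using e h_small by (intro mult_nonneg_nonneg) (auto simp: algebra_simps)
    moreover have "y (Suc k) - x (Suc k) = e * (1 + h * (2 * y k - e)) + h * (1 - lam) * eps"
      using diff_step[of k] by (simp add: e_def algebra_simps)
    moreover have "h * eps * b \<le> h * eps * (1 - lam)"
      using b eps_pos h_pos by (intro mult_left_mono) auto
    moreover have "0 \<le> h * (b * (2 - b) * (y k)\<^sup>2)"
      using b h_pos by (intro mult_nonneg_nonneg) auto
    ultimately show ?case
      by (simp add: y_Suc algebra_simps power2_eq_square)
  qed
qed

text \<open>Above height \<open>rho / 4\<close> the ray bound makes \<open>x + y\<close> contract at
  rate \<open>b * rho / 4\<close> against a source of size \<open>\<bar>lam + 1\<bar> * eps\<close>.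
  Between there and \<open>rho / 2\<close> a height of at least \<open>rho / 8\<close> remains,
  enough to shrink the initial \<open>5 * rho\<close> below \<open>eps\<close>.\<close>

lemma sum_small:
  assumes left: "\<And>n. 0 \<le> y n \<Longrightarrow> y n \<le> 5 / 2 * rho \<Longrightarrow> b * y n \<le> y n - x n"
    and b: "0 < b" "b \<le> 1"
    and small: "exp (- (b * rho\<^sup>2 / (32 * eps))) * (5 * rho) \<le> eps" "eps * h \<le> rho / 8"
    and y: "rho / 2 \<le> y n" "y n \<le> 5 / 2 * rho"
  shows "\<bar>x n + y n\<bar> \<le> (1 + 4 * \<bar>lam + 1\<bar> / (b * rho)) * eps"
proof -
  have below: "y 0 < rho / 4" using entry al by simp
  obtain m where m: "rho / 4 \<le> y m" "y m < rho / 4 + eps * h" "\<And>k. k < m \<Longrightarrow> y k < rho / 4"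
    using first_passage[of "rho / 4"] below by metis
  have mn: "m \<le> n"
    using m(3)[of n] y(1) rho_pos by (cases "n < m") auto
  \<comment> \<open>\<open>B\<close> is the equilibrium size of \<open>\<bar>x + y\<bar>\<close>:
    contraction by \<open>q\<close> balances the source exactly there.\<close>
  define B where "B = 4 * \<bar>lam + 1\<bar> * eps / (b * rho)"
  define q where "q = h * (b * rho / 4)"
  have B: "0 \<le> B" using b rho_pos eps_pos by (simp add: B_def)
  have qB: "h * \<bar>lam + 1\<bar> * eps = q * B"
    using b rho_pos by (simp add: B_def q_def field_simps)
  define v where "v k = max 0 (\<bar>x (m + k) + y (m + k)\<bar> - B)" for k
  have "v (n - m) \<le> exp (- q * real (n - m)) * v 0"
  proof (rule geometric_bound)
    fix i assume i: "i < n - m"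
    define k where "k = m + i"
    have yk: "rho / 4 \<le> y k" "y k \<le> 5 / 2 * rho"
      using m(1) y_mono[of m k] y_mono[of k n] i y less_diff_conv[of i n m] by (auto simp: k_def)
    have "b * (rho / 4) \<le> b * y k" using yk b by (intro mult_left_mono) auto
    then have d: "b * rho / 4 \<le> y k - x k" using left[of k] yk rho_pos by simp
    define f where "f = 1 + h * (x k - y k)"
    have "h * (x k - y k) \<le> h * - (b * rho / 4)" using d h_pos by (intro mult_left_mono) auto
    then have f1: "f \<le> 1 - q" by (simp add: f_def q_def)
    have "h * - (20 * rho) \<le> h * (x k - y k)"
      using x_ge[OF yk(2)] yk rho_pos h_pos by (intro mult_left_mono) auto
    then have f0: "0 \<le> f" using h_small by (simp add: f_def algebra_simps)
    have "\<bar>x (Suc k) + y (Suc k)\<bar> \<le> \<bar>(x k + y k) * f\<bar> + \<bar>h * (lam + 1) * eps\<bar>"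
      unfolding sum_step f_def by (rule abs_triangle_ineq)
    also have "\<dots> = f * \<bar>x k + y k\<bar> + q * B"
      using f0 eps_pos h_pos unfolding qB[symmetric] by (simp add: abs_mult)
    also have "\<dots> \<le> (1 - q) * \<bar>x k + y k\<bar> + q * B"
      using f1 by (intro add_right_mono mult_right_mono) auto
    finally have "\<bar>x (Suc k) + y (Suc k)\<bar> - B \<le> (1 - q) * (\<bar>x k + y k\<bar> - B)"
      by (simp add: algebra_simps)
    also have "\<dots> \<le> (1 - q) * v i"
      using f0 f1 by (intro mult_left_mono) (auto simp: v_def k_def)
    moreover have "0 \<le> (1 - q) * v i" using f0 f1 by (simp add: v_def)
    ultimately show "v (Suc i) \<le> (1 + - q) * v i" by (simp add: v_def k_def)
  qed (simp add: v_def)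
  also have "\<dots> \<le> exp (- (b * rho\<^sup>2 / (32 * eps))) * (5 * rho)"
  proof (intro mult_mono)
    have "rho / 8 / eps \<le> h * real (n - m)"
      unfolding time_eq[OF mn] using m(2) y small(2) eps_pos by (intro divide_right_mono) auto
    then have "b * rho / 4 * (rho / 8 / eps) \<le> b * rho / 4 * (h * real (n - m))"
      using b rho_pos by (intro mult_left_mono) auto
    then show "exp (- q * real (n - m)) \<le> exp (- (b * rho\<^sup>2 / (32 * eps)))"
      by (simp add: q_def power2_eq_square algebra_simps)
    have ym: "0 \<le> y m" "y m \<le> rho" using m small rho_pos by auto
    then have "x m \<le> y m" using left[of m] b rho_pos mult_nonneg_nonneg[of b "y m"] by linarith
    then show "v 0 \<le> 5 * rho"
      using x_ge[of m] ym B rho_pos by (auto simp: v_def)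
  qed (auto simp: v_def)
  finally have "v (n - m) \<le> eps" using small by simp
  then show ?thesis
    using mn by (simp add: v_def B_def algebra_simps)
qed

text \<open>Being \<open>K * eps\<close>-close to \<open>x = - y\<close>, the orbit lies right of
  \<open>- rho\<close> at a height near \<open>rho - j\<close> and left of it near
  \<open>rho + j / 2\<close>. The crossing step has length of order \<open>h * eps\<close>, since
  \<open>x\<^sup>2 - y\<^sup>2\<close> is the product of a small sum and a bounded
  difference.\<close>

lemma crossing_left:
  assumes K: "\<And>n. rho / 2 \<le> y n \<Longrightarrow> y n \<le> 5 / 2 * rho \<Longrightarrow> \<bar>x n + y n\<bar> \<le> K * eps" "0 \<le> K"
    and j: "0 < j" "j \<le> rho / 2" "K * eps < j / 2" "eps * h < j / 4"
  obtains N where "rho - j \<le> y N" "y N < rho + j" "\<bar>x N + rho\<bar> \<le> (6 * rho * K + \<bar>lam\<bar>) * (h * eps)"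
proof -
  have below: "y 0 < rho - j" "y 0 < rho + j / 2" using entry al j by auto
  obtain m where m: "rho - j \<le> y m" "y m < rho - j + eps * h"
    using first_passage[of "rho - j"] below by metis
  obtain M where M: "rho + j / 2 \<le> y M" "y M < rho + j / 2 + eps * h"
    using first_passage[of "rho + j / 2"] below by metis
  have mM: "m < M" using y_less_iff[of m M] m M j by simp
  have xm: "- rho < x m" using K(1)[of m] m j rho_pos by (auto simp: abs_le_iff)
  have xM: "x M \<le> - rho" using K(1)[of M] M j rho_pos by (auto simp: abs_le_iff)
  define crossed where "crossed i \<longleftrightarrow> x (m + i) \<le> - rho" for i
  have "\<not> crossed 0" "crossed (M - m)" using xm xM mM by (simp_all add: crossed_def)
  then obtain k where "k < M - m" "\<forall>i\<le>k. \<not> crossed i" "crossed (Suc k)"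
    using ex_least_nat_less[of crossed "M - m"] by auto
  then have k: "k < M - m" "\<not> x (m + k) \<le> - rho" "x (m + Suc k) \<le> - rho"
    by (auto simp: crossed_def)
  \<comment> \<open>\<open>N\<close> is the last index before the first crossing; the witness
    delivered at the end is \<open>Suc N\<close>.\<close>
  define N where "N = m + k"
  have yN: "rho - j \<le> y N" "y (Suc N) < rho + j / 2 + eps * h"
    using y_mono[of m N] y_mono[of "Suc N" M] k m M less_diff_conv[of k M m] by (auto simp: N_def)
  have yN': "rho / 2 \<le> y N" "y N \<le> 5 / 2 * rho"
    using yN j step_pos rho_pos by (auto simp: y_Suc)
  have "\<bar>x N - y N\<bar> \<le> 6 * rho"
    using K(1)[OF yN'] x_ge[OF yN'(2)] yN' j rho_pos by (auto simp: abs_le_iff)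
  then have "\<bar>x N + y N\<bar> * \<bar>x N - y N\<bar> \<le> (K * eps) * (6 * rho)"
    using K(1)[OF yN'] K(2) eps_pos by (intro mult_mono) auto
  then have "\<bar>(x N)\<^sup>2 - (y N)\<^sup>2\<bar> \<le> (K * eps) * (6 * rho)"
    by (simp add: abs_mult[symmetric] power2_eq_square algebra_simps)
  then have "\<bar>(x N)\<^sup>2 - (y N)\<^sup>2 + lam * eps\<bar> \<le> (K * eps) * (6 * rho) + \<bar>lam\<bar> * eps"
    using abs_triangle_ineq[of "(x N)\<^sup>2 - (y N)\<^sup>2" "lam * eps"] eps_pos by (simp add: abs_mult)
  then have "h * \<bar>(x N)\<^sup>2 - (y N)\<^sup>2 + lam * eps\<bar> \<le> h * ((K * eps) * (6 * rho) + \<bar>lam\<bar> * eps)"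
    using h_pos by (intro mult_left_mono) auto
  then have "\<bar>x (Suc N) - x N\<bar> \<le> (6 * rho * K + \<bar>lam\<bar>) * (h * eps)"
    using h_pos abs_mult[of h "(x N)\<^sup>2 - (y N)\<^sup>2 + lam * eps"] by (simp add: x_Suc) (simp add: algebra_simps)
  moreover have "- rho < x N" "x (Suc N) \<le> - rho" using k by (auto simp: N_def not_le)
  ultimately have "\<bar>x (Suc N) + rho\<bar> \<le> (6 * rho * K + \<bar>lam\<bar>) * (h * eps)" by linarith
  moreover have "rho - j \<le> y (Suc N)" "y (Suc N) < rho + j"
    using yN j step_pos by (auto simp: y_Suc)
  ultimately show ?thesis using that by blast
qed

end

section \<open>Pairs of orbits\<close>

lemma orbit_difference_step:
  assumes "euler_orbit lam eps h x y" "euler_orbit lam eps h x' y"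
  shows "x (Suc n) - x' (Suc n) = (x n - x' n) * (1 + h * (x n + x' n))"
proof -
  interpret o1: euler_orbit lam eps h x y by fact
  interpret o2: euler_orbit lam eps h x' y by fact
  show ?thesis by (simp add: o1.x_Suc o2.x_Suc algebra_simps power2_eq_square)
qed

text \<open>The distance to a second orbit shrinks by \<open>exp (- al\<^sup>2 / (8 * eps))\<close> before height \<open>- al / 2\<close>,
  does not grow before height \<open>- z\<close>, and afterwards grows at most at the crude rate
  \<open>5 * rho\<close>, which costs little because only a short range of heights is left.\<close>

lemma exit_contraction:
  assumes o1: "euler_orbit lam eps h x y" and o2: "euler_orbit lam eps h x' y"
    and start: "y 0 < - al + eps * h" "0 < al" "0 \<le> z" "z \<le> al / 2" "al \<le> rho" "eps * h \<le> al / 4"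
    and low: "\<And>i. y i \<le> - z \<Longrightarrow> - 3 * rho \<le> x i \<and> x i \<le> y i / 2"
    and low': "\<And>i. y i \<le> - z \<Longrightarrow> - 3 * rho \<le> x' i \<and> x' i \<le> y i / 2"
    and mid: "\<And>i. i < n \<Longrightarrow> - z \<le> y i \<Longrightarrow> \<bar>x i\<bar> \<le> 2 * rho"
    and h: "20 * h * rho \<le> 1"
    and yn: "- z \<le> y n" "y n \<le> Y"
    and D: "D = 3 * rho * exp (5 * rho * (Y + z) / eps - al\<^sup>2 / (8 * eps))" "D \<le> rho"
  shows "\<bar>x n - x' n\<bar> \<le> D"
proof -
  interpret o1: euler_orbit lam eps h x y by fact
  note step = orbit_difference_step[OF o1 o2]
  define v where "v i = \<bar>x i - x' i\<bar>" for i
  have vstep: "v (Suc i) = \<bar>1 + h * (x i + x' i)\<bar> * v i" for i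
    by (simp add: v_def step abs_mult mult.commute)
  have rho: "0 < rho" using start by simp
  have factor: "0 \<le> 1 + h * (x i + x' i) \<and> 1 + h * (x i + x' i) \<le> 1 + h * y i" if "y i \<le> - z" for i
  proof -
    have "- (20 * rho) \<le> x i + x' i" "x i + x' i \<le> y i"
      using low[OF that] low'[OF that] rho by auto
    then have "h * (- (20 * rho)) \<le> h * (x i + x' i)" "h * (x i + x' i) \<le> h * y i"
      using o1.h_pos by (intro mult_left_mono; simp)+
    then show ?thesis using h by (simp add: algebra_simps)
  qed
  have below: "y 0 < - al / 2" using start by simp
  obtain m where m: "- al / 2 \<le> y m" "\<And>k. k < m \<Longrightarrow> y k < - al / 2"
    using o1.first_passage[of "- al / 2"] below by metis
  have y0z: "y 0 < - z" using start by simp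
  obtain m2 where m2: "- z \<le> y m2" "\<And>k. k < m2 \<Longrightarrow> y k < - z"
    using o1.first_passage[OF y0z] by metis
  have mm: "m \<le> m2"
    using m2(1) m(2)[of m2] start by (cases "m2 < m") auto
  have mn: "m2 \<le> n" using m2(2)[of n] yn by (meson not_le)
  have "v m \<le> exp (- (al / 2 * h) * real m) * v 0"
  proof (rule geometric_bound)
    fix i assume "i < m"
    then have yi: "y i \<le> - (al / 2)" using m(2)[of i] by simp
    then have "h * y i \<le> h * - (al / 2)" using o1.h_pos by (intro mult_left_mono) auto
    then show "v (Suc i) \<le> (1 + - (al / 2 * h)) * v i"
      using factor[of i] yi start unfolding vstep
      by (intro mult_right_mono) (auto simp: v_def algebra_simps)
  qed (simp add: v_def)
  also have "\<dots> \<le> exp (- (al\<^sup>2 / (8 * eps))) * (3 * rho)"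
  proof (intro mult_mono)
    have "al / (4 * eps) \<le> h * real m"
      using o1.time_eq[of 0 m] m(1) start o1.eps_pos by (simp add: field_simps)
    then have "al / 2 * (al / (4 * eps)) \<le> al / 2 * (h * real m)"
      using start by (intro mult_left_mono) auto
    then show "exp (- (al / 2 * h) * real m) \<le> exp (- (al\<^sup>2 / (8 * eps)))"
      by (simp add: power2_eq_square algebra_simps)
    show "v 0 \<le> 3 * rho" using low[of 0] low'[of 0] y0z start by (auto simp: v_def)
  qed (auto simp: v_def)
  finally have vm: "v m \<le> exp (- (al\<^sup>2 / (8 * eps))) * (3 * rho)" .
  have "v (m + (m2 - m)) \<le> exp (0 * real (m2 - m)) * v (m + 0)"
  proof (rule geometric_bound)
    fix i assume "i < m2 - m"
    then have "m + i < m2" by simp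
    then have yi: "y (m + i) \<le> - z" using m2(2) less_imp_le by blast
    then have "h * y (m + i) \<le> 0"
      using o1.h_pos start by (simp add: mult_nonneg_nonpos)
    then have "\<bar>1 + h * (x (m + i) + x' (m + i))\<bar> * v (m + i) \<le> 1 * v (m + i)"
      using factor[OF yi] by (intro mult_right_mono) (auto simp: v_def)
    then show "v (m + Suc i) \<le> (1 + 0) * v (m + i)"
      by (simp add: vstep)
  qed (simp add: v_def)
  then have vm2: "v m2 \<le> exp (- (al\<^sup>2 / (8 * eps))) * (3 * rho)"
    using vm mm by simp
  define w where "w i = exp (5 * rho * h * real i) * v m2" for i
  have wD: "w i \<le> D" if "i \<le> n - m2" for i
  proof -
    have "h * real i \<le> h * real (n - m2)"
      using that o1.h_pos by (intro mult_left_mono) auto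
    also have "\<dots> \<le> (Y + z) / eps"
      unfolding o1.time_eq[OF mn] using m2 yn o1.eps_pos by (intro divide_right_mono) auto
    finally have "5 * rho * (h * real i) \<le> 5 * rho * ((Y + z) / eps)"
      using rho by (intro mult_left_mono) auto
    then have "w i \<le> exp (5 * rho * (Y + z) / eps) * (exp (- (al\<^sup>2 / (8 * eps))) * (3 * rho))"
      unfolding w_def using vm2 by (intro mult_mono) (auto simp: v_def mult.assoc)
    also have "\<dots> = D" unfolding D(1) by (simp add: exp_diff exp_minus field_simps)
    finally show ?thesis .
  qed
  \<comment> \<open>A bootstrap: only \<open>x\<close> is bounded by \<open>2 * rho\<close> in
    advance. As long as the distance is at most \<open>D \<le> rho\<close>, the sum
    \<open>x + x'\<close> is bounded by \<open>5 * rho\<close>, which in turn preserves the bound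
    \<open>w\<close>.\<close>
  have "v (m2 + i) \<le> w i" if "i \<le> n - m2" for i
    using that
  proof (induction i)
    case 0
    show ?case by (simp add: w_def)
  next
    case (Suc i)
    define k where "k = m2 + i"
    have IH: "v k \<le> w i" "w i \<le> D" using Suc wD[of i] by (auto simp: k_def)
    have "\<bar>x k\<bar> \<le> 2 * rho"
      using mid[of k] Suc.prems m2 o1.y_mono[of m2 k] mn by (auto simp: k_def)
    then have "\<bar>x k + x' k\<bar> \<le> 5 * rho"
      using IH D(2) by (auto simp: v_def)
    then have "\<bar>h * (x k + x' k)\<bar> \<le> h * (5 * rho)"
      using o1.h_pos by (simp add: abs_mult)
    then have "v (Suc k) \<le> (1 + 5 * rho * h) * v k"
      unfolding vstep by (intro mult_right_mono) (auto simp: v_def algebra_simps)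
    also have "\<dots> \<le> exp (5 * rho * h) * w i"
      using IH rho o1.h_pos by (intro mult_mono exp_ge_add_one_self) (auto simp: v_def)
    also have "\<dots> = w (Suc i)" by (simp add: w_def exp_add algebra_simps)
    finally show ?case by (simp add: k_def)
  qed
  from this[of "n - m2"] wD[of "n - m2"] show ?thesis
    using mn by (simp add: v_def)
qed

section \<open>Motion past the origin for \<open>lam > 1\<close>: escape, crossing of
  \<open>x = rho\<close>, spreading of orbits\<close>

context entering_orbit
begin

text \<open>Backwards in time: where \<open>\<bar>y\<bar> \<le> rho\<close> and
  \<open>x > 2 * rho\<close>, the field points to the right, so the next point would also exceed
  \<open>2 * rho\<close>.\<close>

lemma x_bounded_before:
  assumes "0 \<le> lam" "- rho \<le> y i" "y n \<le> rho" "x n \<le> 2 * rho" "i \<le> n"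
  shows "x i \<le> 2 * rho"
  using assms(5,2)
proof (induction rule: inc_induct)
  case base
  then show ?case using assms by simp
next
  case (step i)
  have yi: "- rho \<le> y i" "y i \<le> rho" using step y_mono[of i n] assms by auto
  have next_le: "x (Suc i) \<le> 2 * rho" using step yi step_pos by (simp add: y_Suc)
  show ?case
  proof (rule ccontr)
    assume *: "\<not> x i \<le> 2 * rho"
    have "(y i)\<^sup>2 \<le> (x i)\<^sup>2"
      using yi * rho_pos by (intro abs_le_square_iff[THEN iffD1]) auto
    then have "0 \<le> h * ((x i)\<^sup>2 - (y i)\<^sup>2 + lam * eps)"
      using h_pos eps_pos assms(1) by simp
    then show False using next_le * by (simp add: x_Suc)
  qed
qed

text \<open>Below height \<open>- z\<close> the sum \<open>x + y\<close> is nonpositive, so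
  \<open>x - y\<close> is multiplied by a factor in \<open>[0, 1]\<close> and receives a nonnegative
  source. This covers the heights at which separation from the diagonal is not yet
  available.\<close>

lemma diff_ge_before:
  assumes K: "0 \<le> K" "- K * eps \<le> x 0 - y 0" and lam: "1 \<le> lam"
    and z: "0 \<le> z" "4 * lam * eps \<le> 3 * z\<^sup>2" "y n \<le> - z"
  shows "- K * eps \<le> x n - y n"
  using z(3)
proof (induction n)
  case 0
  show ?case using K by simp
next
  case (Suc n)
  then have yn: "y n \<le> - z" using step_pos by (simp add: y_Suc)
  then have yn': "y n \<le> 5 / 2 * rho" using rho_pos z by simp
  have "x n \<le> y n / 2" using x_le z yn by blast
  then have "h * (x n + y n) \<le> 0" using yn z h_pos by (intro mult_nonneg_nonpos) auto
  then have "- K * eps \<le> (- K * eps) * (1 + h * (x n + y n))"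
    using mult_nonneg_nonpos[of "K * eps" "h * (x n + y n)"] K eps_pos by (simp add: algebra_simps)
  also have "\<dots> \<le> (x n - y n) * (1 + h * (x n + y n))"
    using Suc yn sum_factor_ge(2)[OF yn'] by (intro mult_right_mono) auto
  also have "\<dots> \<le> x (Suc n) - y (Suc n)"
    using lam h_pos eps_pos by (simp add: diff_step)
  finally show ?case .
qed

text \<open>The blow-up estimate is started at the first nonnegative height, where
  \<open>x - y\<close> is already nonnegative. That height may be as large as one step, hence the
  extra \<open>eps * h\<close>.\<close>

lemma escapes:
  assumes a: "0 < a" "a\<^sup>2 = (lam - 1) * eps" "a \<le> rho"
    and sep: "\<And>n. - al / 2 \<le> y n \<Longrightarrow> y n \<le> 5 / 2 * rho \<Longrightarrow> 0 \<le> x n - y n"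
    and step: "eps * h \<le> rho" and y: "eps * h + 4 * eps / a \<le> y n"
  shows "3 * rho \<le> x n - y n"
proof -
  obtain m where m: "0 \<le> y m" "y m < eps * h" "\<And>k. k < m \<Longrightarrow> y k < 0"
    using first_passage[of 0] entry al by (metis add_0 neg_less_0_iff_less order_le_less_trans)
  interpret s: euler_orbit lam eps h "\<lambda>n. x (m + n)" "\<lambda>n. y (m + n)" by (rule shift)
  have "0 \<le> eps * h + 4 * eps / a" using a eps_pos h_pos by simp
  then have mn: "m \<le> n"
    using m(3)[of n] y by (cases "n < m") auto
  have "3 * rho \<le> x (m + (n - m)) - y (m + (n - m))"
  proof (rule s.blow_up[OF a(1,2)])
    show "0 \<le> x (m + 0) - y (m + 0)" using sep[of m] m step al by simp
    have "h * (3 * rho + a) \<le> h * (20 * rho)"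
      using a h_pos by (intro mult_left_mono) auto
    then show "h * (3 * rho + a) \<le> 2" using h_small by (simp add: algebra_simps)
  qed (use m y mn rho_pos in auto)
  then show ?thesis using mn by simp
qed

text \<open>The witness is the first index with \<open>rho \<le> x\<close>. Its predecessor
  satisfies \<open>\<bar>x\<bar> \<le> rho\<close>, which bounds the last jump. The height is
  confined from below by the ray barrier and from above by the escape bound.\<close>

lemma crossing_right:
  assumes lam: "0 \<le> lam" "lam * eps \<le> rho\<^sup>2"
    and sep: "\<And>n. - al / 2 \<le> y n \<Longrightarrow> y n \<le> 5 / 2 * rho \<Longrightarrow> 0 \<le> x n - y n"
    and z: "0 \<le> z" "4 * lam * eps \<le> 3 * z\<^sup>2" "z + eps * h \<le> al / 2"
    and Y: "\<And>n. Y \<le> y n \<Longrightarrow> 3 * rho \<le> x n - y n" "0 \<le> Y" "Y \<le> rho"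
  obtains N where "- z \<le> y N" "y N \<le> Y + eps * h" "\<bar>x N - rho\<bar> \<le> h * (rho\<^sup>2 + lam * eps)"
proof -
  obtain M where "Y < y M" using unbounded by blast
  then have M: "rho \<le> x M" using Y(1)[of M] Y(2) rho_pos by simp
  have "\<not> rho \<le> x 0" using entry al by simp
  then obtain k where "k < M" "\<forall>i\<le>k. \<not> rho \<le> x i" "rho \<le> x (Suc k)"
    using ex_least_nat_less[of "\<lambda>i. rho \<le> x i" M] M by auto
  then have k: "x k < rho" "rho \<le> x (Suc k)" by (auto simp: not_le)
  have y1: "- z \<le> y (Suc k)"
    using x_le[OF z(1,2), of "Suc k"] k rho_pos z(1) by (cases "y (Suc k) \<le> - z") auto
  then have y2: "- al / 2 \<le> y k" using z(3) by (simp add: y_Suc)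
  have y3: "y k \<le> Y" using Y(1)[of k] Y(2) k rho_pos by (cases "Y \<le> y k") auto
  then have "y k \<le> x k" using sep[of k] y2 Y(3) rho_pos by simp
  then have "\<bar>x k\<bar> \<le> rho" using k y2 al by simp
  then have "(x k)\<^sup>2 \<le> rho\<^sup>2" using abs_le_square_iff[of "x k" rho] rho_pos by simp
  then have "h * ((x k)\<^sup>2 - (y k)\<^sup>2 + lam * eps) \<le> h * (rho\<^sup>2 + lam * eps)"
    using h_pos by (intro mult_left_mono) (auto simp: algebra_simps add_increasing2)
  then have "\<bar>x (Suc k) - rho\<bar> \<le> h * (rho\<^sup>2 + lam * eps)"
    using k by (simp add: x_Suc)
  moreover have "y (Suc k) \<le> Y + eps * h" using y3 by (simp add: y_Suc)
  ultimately show ?thesis using that y1 by blast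
qed

end

text \<open>With \<open>d = y' - y\<close>, the excess \<open>E = x' - x - d\<close> satisfies
  \<open>E' = E (1 + h (x + x')) + h d ((x - y) + (x' - y'))\<close>; the last term becomes positive
  once both orbits lie to the right of the diagonal.\<close>

lemma orbits_spread:
  assumes o1: "entering_orbit lam eps h x y rho al" and o2: "entering_orbit lam eps h x' y' rho al"
    and d: "\<And>n. y' n = y n + d" "0 < d" "d \<le> al / 8"
    and lam: "1 \<le> lam" "256 * lam * eps \<le> 3 * al\<^sup>2"
    and K: "0 \<le> K" "- K * eps \<le> x 0 - y 0" "- K * eps \<le> x' 0 - y' 0" "- K * eps * d \<le> x' 0 - x 0 - d"
    and c: "0 \<le> c" "(K + 8 * K / al) * eps \<le> c * al / 4"
    and sep: "\<And>n. - al / 2 \<le> y n \<Longrightarrow> y n \<le> 5 / 2 * rho \<Longrightarrow> c * eps \<le> x n - y n"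
    and sep': "\<And>n. - al / 2 \<le> y' n \<Longrightarrow> y' n \<le> 5 / 2 * rho \<Longrightarrow> c * eps \<le> x' n - y' n"
    and step: "eps * h \<le> al / 8"
    and n: "- al / 4 \<le> y n" "y' n \<le> 5 / 2 * rho"
  shows "d \<le> x' n - x n"
proof -
  interpret o1: entering_orbit lam eps h x y rho al by fact
  interpret o2: entering_orbit lam eps h x' y' rho al by fact
  note al = o1.al and h = o1.h_pos and eps = o1.eps_pos and rho = o1.rho_pos
  define E where "E i = x' i - x i - d" for i
  define p where "p i = x i + x' i" for i
  have E_Suc: "E (Suc i) = E i * (1 + h * p i) + h * d * ((x i - y i) + (x' i - y' i))" for i
    by (simp add: E_def p_def o1.x_Suc o2.x_Suc d(1) algebra_simps power2_eq_square)
  have z: "0 \<le> al / 8" "4 * lam * eps \<le> 3 * (al / 8)\<^sup>2"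
    using al lam by (auto simp: power_divide)
  have p_ge: "0 \<le> 1 + h * p i" if "y' i \<le> 5 / 2 * rho" for i
  proof -
    have "h * - (20 * rho) \<le> h * p i"
      using o1.x_ge[of i] o2.x_ge[of i] that d h rho by (intro mult_left_mono) (auto simp: p_def)
    then show ?thesis using o1.h_small by (simp add: algebra_simps)
  qed
  have p_le: "p i \<le> y' i" if "y' i \<le> - (al / 8)" for i
    using o1.x_le[OF z, of i] o2.x_le[OF z, of i] that d by (simp add: p_def)
  have below: "y 0 < - (al / 2)" "y 0 < - (al / 4)" using o1.entry al by auto
  obtain m where m: "- (al / 2) \<le> y m" "y m < - (al / 2) + eps * h" "\<And>k. k < m \<Longrightarrow> y k < - (al / 2)"
    using o1.first_passage[of "- (al / 2)"] below by metis
  obtain M where M: "- (al / 4) \<le> y M" "\<And>k. k < M \<Longrightarrow> y k < - (al / 4)"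
    using o1.first_passage[of "- (al / 4)"] below by metis
  have mM: "m \<le> M" using M(1) m(3)[of M] al by (cases "M < m") auto
  have Mn: "M \<le> n" using n M(2)[of n] by (cases "n < M") auto
  \<comment> \<open>Chosen so that the damping \<open>h * L * al / 4\<close> dominates
    \<open>2 * h * K\<close>, the worst negative forcing while both orbits may still lie left of the
    diagonal by \<open>K * eps\<close>.\<close>
  define L where "L = K + 8 * K / al"
  have L: "0 \<le> L" "K \<le> L" using K al by (auto simp: L_def)
  have "- L * eps * d \<le> E i" if "i \<le> m" for i
    using that
  proof (induction i)
    case 0
    have "K * eps * d \<le> L * eps * d"
      using L d eps by (intro mult_right_mono) auto
    then show ?case using K by (simp add: E_def)
  next
    case (Suc i)
    have yi: "y i < - (al / 2)" using m(3)[of i] Suc.prems by simp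
    then have yi': "y' i \<le> - (al / 4)" "y' i \<le> - (al / 8)" "y i \<le> - (al / 8)" "y' i \<le> 5 / 2 * rho"
      using d al rho by auto
    have "h * p i \<le> h * - (al / 4)"
      using p_le[OF yi'(2)] yi' h by (intro mult_left_mono) auto
    then have "L * (h * p i) \<le> L * (h * - (al / 4))"
      by (rule mult_left_mono[OF _ L(1)])
    also have "\<dots> = - (h * K * al / 4) - 2 * h * K"
      using al by (simp add: L_def field_simps)
    also have "\<dots> \<le> - (2 * h * K)" using h K al by simp
    finally have "eps * d * (L * (h * p i)) \<le> eps * d * - (2 * h * K)"
      using eps d by (intro mult_left_mono) auto
    then have "- L * eps * d \<le> - L * eps * d * (1 + h * p i) + h * d * (- K * eps + - K * eps)"
      by (simp add: algebra_simps)
    also have "\<dots> \<le> E (Suc i)"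
      unfolding E_Suc
      using Suc p_ge[OF yi'(4)] h d o1.diff_ge_before[OF K(1,2) lam(1) z yi'(3)]
        o2.diff_ge_before[OF K(1,3) lam(1) z yi'(2)]
      by (intro add_mono mult_right_mono mult_left_mono) auto
    finally show ?case .
  qed
  then have Em: "- L * eps * d \<le> E m" by simp
  have "min 0 (- L * eps * d + real i * (2 * h * d * c * eps)) \<le> E (m + i)" if "i \<le> M - m" for i
    using that
  proof (induction i)
    case 0
    show ?case using Em by simp
  next
    case (Suc i)
    define k where "k = m + i"
    have yk: "y k < - (al / 4)" using M(2)[of k] Suc.prems by (simp add: k_def)
    have yk2: "- al / 2 \<le> y k" using m(1) o1.y_mono[of m k] by (simp add: k_def)
    have yk': "y' k \<le> - (al / 8)" "y' k \<le> 5 / 2 * rho" "y k \<le> 5 / 2 * rho" "- al / 2 \<le> y' k"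
      using yk yk2 d al rho by auto
    have hp: "h * p k \<le> 0" using p_le[OF yk'(1)] yk' al h by (intro mult_nonneg_nonpos) auto
    have "h * d * (c * eps + c * eps) \<le> h * d * ((x k - y k) + (x' k - y' k))"
      using sep[OF yk2 yk'(3)] sep'[OF yk'(4,2)] h d by (intro mult_left_mono) auto
    then have *: "E k * (1 + h * p k) + 2 * h * d * c * eps \<le> E (Suc k)"
      unfolding E_Suc by (simp add: algebra_simps)
    have pos: "0 \<le> 2 * h * d * c * eps" using h d c eps by simp
    show ?case
    proof (cases "0 \<le> E k")
      case True
      then have "0 \<le> E k * (1 + h * p k)" using p_ge[OF yk'(2)] by simp
      then have "0 \<le> E (Suc k)" using * pos by linarith
      then show ?thesis by (simp add: k_def min.coboundedI1)
    next
      case False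
      then have "E k \<le> E k * (1 + h * p k)"
        using mult_nonpos_nonpos[of "E k" "h * p k"] hp by (simp add: algebra_simps)
      then show ?thesis using * pos Suc False by (simp add: k_def algebra_simps)
    qed
  qed
  from this[of "M - m"] have "min 0 (- L * eps * d + real (M - m) * (2 * h * d * c * eps)) \<le> E M"
    using mM by simp
  moreover have "0 \<le> - L * eps * d + real (M - m) * (2 * h * d * c * eps)"
  proof -
    have "al / 8 \<le> h * real (M - m) * eps"
      unfolding o1.time_eq[OF mM] using m(2) M(1) step eps by simp
    then have "2 * d * c * (al / 8) \<le> 2 * d * c * (h * real (M - m) * eps)"
      by (rule mult_left_mono) (use d c in simp)
    moreover have "d * (L * eps) \<le> d * (c * al / 4)"
      using c(2) d by (intro mult_left_mono) (auto simp: L_def)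
    ultimately show ?thesis by (simp add: algebra_simps del: of_nat_diff)
  qed
  ultimately have EM: "0 \<le> E M" by simp
  have "0 \<le> E n"
    using Mn n(2)
  proof (induction n rule: dec_induct)
    case base
    show ?case using EM .
  next
    case (step k)
    then have yk: "y' k \<le> 5 / 2 * rho" using o2.y_mono[of k "Suc k"] by simp
    then have "y k \<le> 5 / 2 * rho" "- al / 2 \<le> y k" "- al / 2 \<le> y' k"
      using d M(1) o1.y_mono[of M k] step al by auto
    then have "0 \<le> (x k - y k) + (x' k - y' k)"
      using sep[of k] sep'[of k] yk mult_nonneg_nonneg[of c eps] c eps by linarith
    then show ?case
      using step yk p_ge[OF yk] h d unfolding E_Suc by simp
  qed
  then show ?thesis by (simp add: E_def)
qed

section \<open>Transition maps\<close>

lemma powr_ge_exp: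
  fixes c C rho h eps :: real
  assumes "0 < c" "c < rho * h" "rho * h \<le> 1 / 2" "0 \<le> C" "0 < rho" "0 < h" "0 < eps"
  shows "exp (- (2 * C * rho\<^sup>2 / eps)) \<le> (1 - c) powr (C * rho / (h * eps))"
proof -
  have "- (2 * c) \<le> - c - 2 * c\<^sup>2"
    using assms mult_left_mono[of c "1 / 2" c] by (simp add: power2_eq_square)
  also have "\<dots> \<le> ln (1 - c)"
    using assms by (intro ln_one_minus_pos_lower_bound) auto
  finally have "- (2 * (rho * h)) \<le> ln (1 - c)" using assms by simp
  then have "C * rho / (h * eps) * - (2 * (rho * h)) \<le> C * rho / (h * eps) * ln (1 - c)"
    using assms by (intro mult_left_mono) auto
  moreover have "C * rho / (h * eps) * - (2 * (rho * h)) = - (2 * C * rho\<^sup>2 / eps)"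
    using assms by (simp add: power2_eq_square field_simps)
  moreover have "(1 - c) powr (C * rho / (h * eps)) = exp (C * rho / (h * eps) * ln (1 - c))"
    using assms by (simp add: powr_def)
  ultimately show ?thesis
    by (simp only: exp_le_cancel_iff)
qed

lemma le_infdist:
  assumes "D \<noteq> {}" "\<And>p. p \<in> D \<Longrightarrow> t \<le> dist q p"
  shows "t \<le> infdist q D"
  using assms by (auto simp: infdist_notempty intro!: cINF_greatest)

lemma fst_diff_le_infdist:
  assumes "D \<noteq> {}" "\<And>p. p \<in> D \<Longrightarrow> fst p = a"
  shows "\<bar>fst q - a\<bar> \<le> infdist q D"
  using assms dist_fst_le[of q] by (intro le_infdist) (auto simp: dist_real_def)

lemma transition_map_minimal:
  assumes "0 < eps" "0 < h" "D \<noteq> {}" "\<And>p. p \<in> D \<Longrightarrow> snd p \<le> b"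
  obtains n where "transition_map lam eps h D p = euler_iter lam eps h n p"
    "\<And>m. infdist (euler_iter lam eps h n p) D \<le> infdist (euler_iter lam eps h m p) D"
proof -
  define f where "f n = infdist (euler_iter lam eps h n p) D" for n
  interpret euler_orbit lam eps h "\<lambda>n. fst (euler_iter lam eps h n p)" "\<lambda>n. snd (euler_iter lam eps h n p)"
    using assms by (intro euler_orbit_iter)
  obtain N where N: "b + f 0 < snd (euler_iter lam eps h N p)" using unbounded by blast
  have late: "f 0 \<le> f n" if "N \<le> n" for n
    unfolding f_def[of n]
  proof (rule le_infdist[OF assms(3)])
    fix q assume "q \<in> D"
    then have "f 0 \<le> dist (snd (euler_iter lam eps h n p)) (snd q)"
      using assms(4)[of q] y_mono[OF that] N by (simp add: dist_real_def)
    then show "f 0 \<le> dist (euler_iter lam eps h n p) q"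
      using dist_snd_le[of "euler_iter lam eps h n p" q] by linarith
  qed
  obtain n where n: "n \<in> {..N}" "\<And>m. m \<in> {..N} \<Longrightarrow> f n \<le> f m"
    using ex_is_arg_min_if_finite[of "{..N}" f] by (auto simp: is_arg_min_linorder)
  have "f n \<le> f m" for m
    using n(2)[of m] n(2)[of 0] late[of m] by (cases "m \<le> N") auto
  then have "is_arg_min f (\<lambda>n. True) n" by (simp add: is_arg_min_linorder)
  then have "is_arg_min f (\<lambda>n. True) (arg_min f (\<lambda>n. True))"
    unfolding arg_min_def by (rule someI)
  then show ?thesis
    using that[of "arg_min f (\<lambda>n. True)"]
    by (simp add: transition_map_def is_arg_min_linorder f_def[abs_def])
qed

lemma continuous_on_euler_iter: "continuous_on UNIV (euler_iter lam eps h n)"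
proof (induction n)
  case (Suc n)
  have "euler_iter lam eps h (Suc n) = (\<lambda>p. (fst (euler_iter lam eps h n p) +
    h * ((fst (euler_iter lam eps h n p))\<^sup>2 - (snd (euler_iter lam eps h n p))\<^sup>2 + lam * eps),
    snd (euler_iter lam eps h n p) + eps * h))"
    by (intro ext prod_eqI) (simp_all add: fst_euler_iter_Suc snd_euler_iter algebra_simps)
  with Suc show ?case by (auto intro!: continuous_intros)
qed (simp add: continuous_on_id[unfolded id_def])

section \<open>Slow manifolds and their extensions\<close>

locale slow_graph =
  fixes lam eps h s K l r :: real and \<phi> :: "real \<Rightarrow> real" and S :: "(real \<times> real) set"
  assumes eps_pos: "0 < eps" and h_pos: "0 < h" and K_nonneg: "0 \<le> K"
    and S_eq: "S = (\<lambda>y. (\<phi> y, y)) ` {l..r}"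
    and near: "l \<le> y \<Longrightarrow> y \<le> r \<Longrightarrow> \<bar>\<phi> y - s * y\<bar> \<le> K * eps"
    and slope: "l \<le> y \<Longrightarrow> y \<le> y' \<Longrightarrow> y' \<le> r \<Longrightarrow> \<bar>\<phi> y' - \<phi> y - s * (y' - y)\<bar> \<le> K * eps * (y' - y)"
    and invariant: "l \<le> y \<Longrightarrow> y + eps * h \<le> r \<Longrightarrow> euler_iter lam eps h 1 (\<phi> y, y) = (\<phi> (y + eps * h), y + eps * h)"
begin

lemma step_pos: "0 < eps * h"
  using eps_pos h_pos by simp

lemma continuous_graph: "continuous_on {l..r} \<phi>"
proof -
  have *: "\<bar>\<phi> y' - \<phi> y\<bar> \<le> (\<bar>s\<bar> + K * eps) * (y' - y)" if "l \<le> y" "y \<le> y'" "y' \<le> r" for y y'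
  proof -
    have "\<bar>s * (y' - y)\<bar> = \<bar>s\<bar> * (y' - y)" using that by (simp add: abs_mult)
    then show ?thesis
      using slope[OF that] abs_triangle_ineq[of "\<phi> y' - \<phi> y - s * (y' - y)" "s * (y' - y)"]
      unfolding distrib_right by simp
  qed
  have "(\<bar>s\<bar> + K * eps)-lipschitz_on {l..r} \<phi>"
  proof (rule lipschitz_onI)
    show "dist (\<phi> y) (\<phi> y') \<le> (\<bar>s\<bar> + K * eps) * dist y y'" if "y \<in> {l..r}" "y' \<in> {l..r}" for y y'
      using *[of y y'] *[of y' y] that by (cases "y \<le> y'") (auto simp: dist_real_def abs_minus_commute)
  qed (use K_nonneg eps_pos in simp)
  then show ?thesis by (rule lipschitz_on_continuous_on)
qed

lemma iter_graph:
  assumes "l \<le> z" "z + real j * (eps * h) \<le> r"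
  shows "euler_iter lam eps h j (\<phi> z, z) = (\<phi> (z + real j * (eps * h)), z + real j * (eps * h))"
  using assms(2)
proof (induction j)
  case (Suc j)
  have eq: "z + real (Suc j) * (eps * h) = z + real j * (eps * h) + eps * h"
    by (simp add: algebra_simps)
  have "l \<le> z + real j * (eps * h)" using assms(1) step_pos by (simp add: add_increasing2)
  then show ?case
    using Suc step_pos invariant[of "z + real j * (eps * h)"]
    unfolding euler_iter_Suc eq by simp
qed simp

definition ext :: "nat \<Rightarrow> real \<Rightarrow> real" where
  "ext n y = fst (euler_iter lam eps h n (\<phi> (y - real n * (eps * h)), y - real n * (eps * h)))"

lemma euler_iter_ext:
  "euler_iter lam eps h n (\<phi> (y - real n * (eps * h)), y - real n * (eps * h)) = (ext n y, y)"
  by (intro prod_eqI) (simp_all add: ext_def snd_euler_iter)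

lemma ext_in_extension:
  assumes "l \<le> y - real n * (eps * h)" "y - real n * (eps * h) \<le> r"
  shows "(ext n y, y) \<in> forward_extension lam eps h S"
  unfolding forward_extension_def S_eq using assms euler_iter_ext[of n y]
  by (intro UN_I[of n] image_eqI[of _ _ "(\<phi> (y - real n * (eps * h)), y - real n * (eps * h))"]) auto

lemma continuous_ext:
  assumes "\<And>y. y \<in> A \<Longrightarrow> l \<le> y - real n * (eps * h) \<and> y - real n * (eps * h) \<le> r"
  shows "continuous_on A (ext n)"
proof -
  have "continuous_on A (\<lambda>y. \<phi> (y - real n * (eps * h)))"
    using assms by (intro continuous_on_compose2[OF continuous_graph] continuous_intros) auto
  then have "continuous_on A (\<lambda>y. fst (euler_iter lam eps h n (\<phi> (y - real n * (eps * h)), y - real n * (eps * h))))"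
    by (intro continuous_on_fst continuous_on_compose2[OF continuous_on_euler_iter] continuous_intros) auto
  then show ?thesis by (simp add: ext_def[abs_def])
qed

text \<open>Past the end \<open>r\<close> of the graph, the extension consists of the iterates of the last
  fundamental domain.\<close>

lemma extension_cases:
  assumes "q \<in> forward_extension lam eps h S" "l < r"
  shows "(\<exists>y. l \<le> y \<and> y \<le> r \<and> q = (\<phi> y, y)) \<or>
    (\<exists>z m. l \<le> z \<and> r - eps * h < z \<and> z \<le> r \<and> q = euler_iter lam eps h m (\<phi> z, z))"
proof -
  obtain m z where "l \<le> z" "z \<le> r" "q = euler_iter lam eps h m (\<phi> z, z)"
    using assms(1) unfolding forward_extension_def S_eq by auto
  then show ?thesis
  proof (induction m arbitrary: z)
    case 0
    then show ?case by auto
  next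
    case (Suc m)
    show ?case
    proof (cases "z + eps * h \<le> r")
      case True
      have "q = euler_iter lam eps h m (\<phi> (z + eps * h), z + eps * h)"
        using Suc.prems invariant[of z] True euler_iter_add[of lam eps h m 1 "(\<phi> z, z)"] by simp
      then show ?thesis
        using Suc.IH[of "z + eps * h"] True Suc.prems step_pos by auto
    next
      case False
      then show ?thesis using Suc.prems by (intro disjI2 exI[of _ z] exI[of _ "Suc m"]) auto
    qed
  qed
qed

lemma extension_eq_ext:
  assumes "(x, y) \<in> forward_extension lam eps h S" "r < y" "l < r"
    and n: "l \<le> y - real n * (eps * h)" "y - real n * (eps * h) \<le> r"
  shows "x = ext n y"
proof -
  obtain z m where z: "r - eps * h < z" "z \<le> r" "(x, y) = euler_iter lam eps h m (\<phi> z, z)"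
    using extension_cases[OF assms(1,3)] assms(2) by auto
  then have y: "y = z + real m * (eps * h)"
    using snd_euler_iter[of lam eps h m "(\<phi> z, z)"] by (metis snd_conv)
  have "(real m - real n) * (eps * h) < 1 * (eps * h)"
    using n z y by (simp add: algebra_simps)
  then have "real m - real n < 1"
    by (rule mult_right_less_imp_less) (use step_pos in simp)
  then have mn: "m \<le> n" by linarith
  define w where "w = y - real n * (eps * h)"
  have zw: "z = w + real (n - m) * (eps * h)"
    using mn by (simp add: w_def y of_nat_diff algebra_simps)
  have "euler_iter lam eps h (n - m) (\<phi> w, w) = (\<phi> z, z)"
    using iter_graph[of w "n - m"] n z unfolding zw w_def by simp
  then have "euler_iter lam eps h n (\<phi> w, w) = (x, y)"
    using euler_iter_add[of lam eps h m "n - m" "(\<phi> w, w)"] mn z by simp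
  then show ?thesis by (simp add: ext_def w_def)
qed

end

lemma slow_manifold_graph:
  assumes S: "slow_manifold lam B {l..r} S" and "l < r"
    and B: "\<And>x y. (x, y) \<in> B \<Longrightarrow> x = s * y"
  obtains eps1 h1 K where "0 < eps1" "0 < h1" "0 \<le> K"
    "\<And>eps h. 0 < eps \<Longrightarrow> eps \<le> eps1 \<Longrightarrow> 0 < h \<Longrightarrow> h \<le> h1 \<Longrightarrow> \<exists>\<phi>. slow_graph lam eps h s K l r \<phi> (S eps h)"
proof -
  define good where "good g g' eps1 h1 K \<longleftrightarrow>
      (\<forall>eps h. 0 < eps \<and> eps \<le> eps1 \<and> 0 < h \<and> h \<le> h1 \<longrightarrow>
           (\<forall>p\<in>S eps h. snd (euler_iter lam eps h 1 p) \<in> {l..r} \<longrightarrow> euler_iter lam eps h 1 p \<in> S eps h) \<and>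
           (\<exists>\<phi> \<phi>'. S eps h = (\<lambda>y. (\<phi> y, y)) ` {l..r} \<and> continuous_on {l..r} \<phi>' \<and>
              (\<forall>y\<in>{l..r}. (\<phi> has_real_derivative \<phi>' y) (at y within {l..r}) \<and>
                     \<bar>\<phi> y - g y\<bar> \<le> K * eps \<and> \<bar>\<phi>' y - g' y\<bar> \<le> K * eps)))"
    for g g' :: "real \<Rightarrow> real" and eps1 h1 K
  have "\<exists>g g'. (\<forall>y\<in>{l..r}. (g y, y) \<in> B \<and> (g has_real_derivative g' y) (at y within {l..r})) \<and>
      (\<exists>eps1>0. \<exists>h1>0. \<exists>K. good g g' eps1 h1 K)"
    using S unfolding slow_manifold_def good_def .
  then obtain g g' eps1 h1 K
    where g: "\<forall>y\<in>{l..r}. (g y, y) \<in> B \<and> (g has_real_derivative g' y) (at y within {l..r})"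
      and pos: "eps1 > 0" "h1 > 0" and main: "good g g' eps1 h1 K"
    by blast
  show ?thesis
  proof (rule that[of eps1 h1 "max K 0"])
    fix eps h :: real
    assume eh: "0 < eps" "eps \<le> eps1" "0 < h" "h \<le> h1"
    have inv: "\<And>p. p \<in> S eps h \<Longrightarrow> snd (euler_iter lam eps h 1 p) \<in> {l..r} \<Longrightarrow> euler_iter lam eps h 1 p \<in> S eps h"
      and graph: "\<exists>\<phi> \<phi>'. S eps h = (\<lambda>y. (\<phi> y, y)) ` {l..r} \<and> continuous_on {l..r} \<phi>' \<and>
              (\<forall>y\<in>{l..r}. (\<phi> has_real_derivative \<phi>' y) (at y within {l..r}) \<and>
                     \<bar>\<phi> y - g y\<bar> \<le> K * eps \<and> \<bar>\<phi>' y - g' y\<bar> \<le> K * eps)"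
      using main[unfolded good_def, THEN spec, THEN spec, THEN mp, OF conjI[OF eh(1) conjI[OF eh(2) conjI[OF eh(3,4)]]]]
      by (elim conjE, blast, elim conjE)
    obtain \<phi> \<phi>' where \<phi>: "S eps h = (\<lambda>y. (\<phi> y, y)) ` {l..r}"
      and "\<forall>y\<in>{l..r}. (\<phi> has_real_derivative \<phi>' y) (at y within {l..r}) \<and>
                     \<bar>\<phi> y - g y\<bar> \<le> K * eps \<and> \<bar>\<phi>' y - g' y\<bar> \<le> K * eps"
      using graph by blast
    note d = bspec[OF this(2)]
    have gs: "g y = s * y" if "y \<in> {l..r}" for y using g that B by blast
    have K: "K * eps \<le> max K 0 * eps" using eh by (intro mult_right_mono) auto
    have "slow_graph lam eps h s (max K 0) l r \<phi> (S eps h)"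
    proof
      show "\<bar>\<phi> y - s * y\<bar> \<le> max K 0 * eps" if "l \<le> y" "y \<le> r" for y
        using d[of y] gs[of y] K that by auto
      show "\<bar>\<phi> y' - \<phi> y - s * (y' - y)\<bar> \<le> max K 0 * eps * (y' - y)" if "l \<le> y" "y \<le> y'" "y' \<le> r" for y y'
      proof -
        have "norm ((\<phi> y' - g y') - (\<phi> y - g y)) \<le> (max K 0 * eps) * norm (y' - y)"
        proof (rule field_differentiable_bound[of "{l..r}" "\<lambda>y. \<phi> y - g y" "\<lambda>y. \<phi>' y - g' y"])
          show "((\<lambda>y. \<phi> y - g y) has_real_derivative \<phi>' z - g' z) (at z within {l..r})" if "z \<in> {l..r}" for z
            using d[OF that] g that by (intro DERIV_diff) auto
          show "norm (\<phi>' z - g' z) \<le> max K 0 * eps" if "z \<in> {l..r}" for z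
            using d[OF that] K by auto
        qed (use that in auto)
        then show ?thesis using gs[of y] gs[of y'] that by (simp add: algebra_simps)
      qed
      show "euler_iter lam eps h 1 (\<phi> y, y) = (\<phi> (y + eps * h), y + eps * h)"
        if "l \<le> y" "y + eps * h \<le> r" for y
      proof -
        have yr: "y \<le> r" "l \<le> y + eps * h" using that mult_pos_pos[OF eh(1) eh(3)] by auto
        have s: "snd (euler_iter lam eps h 1 (\<phi> y, y)) = y + eps * h"
          by (simp only: euler_iter_1 snd_conv)
        have "euler_iter lam eps h 1 (\<phi> y, y) \<in> S eps h"
          using that yr s by (intro inv) (auto simp: \<phi>)
        then show ?thesis using s unfolding \<phi> by auto
      qed
    qed (use eh \<phi> in auto)
    then show "\<exists>\<phi>. slow_graph lam eps h s (max K 0) l r \<phi> (S eps h)" by blast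
  qed (use pos in auto)
qed

section \<open>Passage for \<open>lam < 1\<close>\<close>

lemma entering_orbit_of_section:
  assumes "0 < eps" "0 < h" "20 * h * rho \<le> 1" "\<bar>lam\<bar> * eps \<le> rho\<^sup>2" "0 < al" "al \<le> rho / 2"
    and J: "J \<subseteq> {- (rho / 4)<..<rho / 4}" and p: "p \<in> Delta_in rho J"
  shows "entering_orbit lam eps h (\<lambda>n. fst (euler_iter lam eps h n p))
    (\<lambda>n. snd (euler_iter lam eps h n p)) rho al"
proof -
  interpret euler_orbit lam eps h "\<lambda>n. fst (euler_iter lam eps h n p)" "\<lambda>n. snd (euler_iter lam eps h n p)"
    using assms by (intro euler_orbit_iter)
  have "snd p + rho \<in> J" "fst p = - rho" using p by (auto simp: Delta_in_def)
  then have "- (rho / 4) < snd p + rho" "snd p + rho < rho / 4" "fst p = - rho" using J by auto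
  then show ?thesis using assms by unfold_locales auto
qed

lemma (in slow_graph) increasing_graph:
  assumes "s = 1" "K * eps \<le> 1 / 2" "l \<le> y" "y < y'" "y' \<le> r"
  shows "\<phi> y < \<phi> y'"
proof -
  have "K * eps * (y' - y) \<le> 1 / 2 * (y' - y)"
    using assms by (intro mult_right_mono) auto
  with abs_le_D2[OF slope[OF assms(3) less_imp_le[OF assms(4)] assms(5)]]
  have "- (\<phi> y' - \<phi> y - s * (y' - y)) \<le> 1 / 2 * (y' - y)" by (rule order_trans)
  then show ?thesis using assms(1,4) by simp
qed


lemma unique_entry:
  assumes "slow_graph lam eps h 1 K (- bm) (- am) \<phi> S"
    and "0 < am" "am < rho" "rho < bm"
    and J: "J \<subseteq> {- (rho / 4)<..<rho / 4}" "{- j<..<j} \<subseteq> J" "0 < j"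
    and K: "K * eps \<le> 1 / 2" "2 * (K * eps) < j" "2 * (K * eps) \<le> bm - rho" "2 * (K * eps) \<le> rho - am"
    and M: "eps * h + K * eps \<le> (rho - am) / 2" "(am + eps * h)\<^sup>2 \<le> ((rho + am) / 2)\<^sup>2 + lam * eps" "h * (rho + am) \<le> 1"
  shows "\<exists>p. Delta_in rho J \<inter> forward_extension lam eps h S = {p}"
proof -
  interpret slow_graph lam eps h 1 K "- bm" "- am" \<phi> S by fact
  have Ke: "0 \<le> K * eps" using K_nonneg eps_pos by simp
  have "\<exists>y\<ge>- rho - 2 * (K * eps). y \<le> - rho + 2 * (K * eps) \<and> \<phi> y = - rho"
  proof (rule IVT')
    show "\<phi> (- rho - 2 * (K * eps)) \<le> - rho" "- rho \<le> \<phi> (- rho + 2 * (K * eps))"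
      using near[of "- rho - 2 * (K * eps)"] near[of "- rho + 2 * (K * eps)"] assms Ke
      by (auto simp: abs_le_iff)
    show "continuous_on {- rho - 2 * (K * eps)..- rho + 2 * (K * eps)} \<phi>"
      using assms Ke by (intro continuous_on_subset[OF continuous_graph]) auto
  qed (use Ke in auto)
  then obtain y0 where y0: "- rho - 2 * (K * eps) \<le> y0" "y0 \<le> - rho + 2 * (K * eps)" "\<phi> y0 = - rho"
    by blast
  have y0_range: "- bm \<le> y0" "y0 \<le> - am" using y0 assms by auto
  have "(- rho, y0) \<in> Delta_in rho J"
    using y0 K J by (auto simp: Delta_in_def)
  moreover have "(- rho, y0) \<in> forward_extension lam eps h S"
    using ext_in_extension[of y0 0] y0 y0_range by (simp add: ext_def)
  moreover have "q = (- rho, y0)" if q: "q \<in> Delta_in rho J" "q \<in> forward_extension lam eps h S" for q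
  proof -
    have fst_q: "fst q = - rho" and snd_q: "snd q < 0"
      using q(1) J assms by (auto simp: Delta_in_def)
    consider y where "- bm \<le> y" "y \<le> - am" "q = (\<phi> y, y)"
      | z m where "- am - eps * h < z" "- bm \<le> z" "z \<le> - am" "q = euler_iter lam eps h m (\<phi> z, z)"
      using extension_cases[OF q(2)] assms by fastforce
    then show ?thesis
    proof cases
      case 1
      then have "y = y0"
        using increasing_graph[of y y0] increasing_graph[of y0 y] K y0 y0_range fst_q
        by (cases y y0 rule: linorder_cases) auto
      then show ?thesis using 1 y0 by simp
    next
      case 2
      interpret o: euler_orbit lam eps h "\<lambda>n. fst (euler_iter lam eps h n (\<phi> z, z))"
          "\<lambda>n. snd (euler_iter lam eps h n (\<phi> z, z))"
        using eps_pos h_pos by (rule euler_orbit_iter)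
      have "- ((rho + am) / 2) \<le> fst (euler_iter lam eps h m (\<phi> z, z))"
      proof (rule o.lower_barrier)
        show "- ((rho + am) / 2) \<le> fst (euler_iter lam eps h 0 (\<phi> z, z))"
          using near[of z] 2 M(1) by (simp add: abs_le_iff field_simps)
        show "(snd (euler_iter lam eps h k (\<phi> z, z)))\<^sup>2 \<le> ((rho + am) / 2)\<^sup>2 + lam * eps" if "k < m" for k
        proof -
          have "\<bar>snd (euler_iter lam eps h k (\<phi> z, z))\<bar> \<le> am + eps * h"
            using o.y_mono[of 0 k] o.y_mono[of k m] that 2 snd_q assms step_pos by (auto simp: abs_le_iff)
          then have "(snd (euler_iter lam eps h k (\<phi> z, z)))\<^sup>2 \<le> (am + eps * h)\<^sup>2"
            using power_mono[of "\<bar>snd (euler_iter lam eps h k (\<phi> z, z))\<bar>" "am + eps * h" 2] by simp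
          then show ?thesis using M(2) by simp
        qed
      qed (use assms M in \<open>auto simp: algebra_simps\<close>)
      then show ?thesis using 2 fst_q assms by (simp add: field_simps)
    qed
  qed
  ultimately show ?thesis by blast
qed

lemma attracted_to_slow_graph:
  assumes o: "entering_orbit lam eps h x y rho al" and g: "slow_graph lam eps h (- 1) Kp ap bp \<phi> S"
    and t: "rho / 2 \<le> t" "ap \<le> t" "t < rho" "rho < bp"
    and K: "\<And>n. rho / 2 \<le> y n \<Longrightarrow> y n \<le> 5 / 2 * rho \<Longrightarrow> \<bar>x n + y n\<bar> \<le> K * eps" "0 \<le> K"
    and n: "\<bar>x n + rho\<bar> \<le> r0" "\<bar>y n - rho\<bar> \<le> rho / 2"
    and small: "K * eps + r0 \<le> (rho - t) / 2" "K * eps + r0 \<le> (bp - rho) / 2"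
      "(K + Kp) * eps \<le> 1" "(K + Kp) * eps \<le> rho / 2" "Kp * eps \<le> 1 / 2" "eps * h \<le> (rho - t) / 4"
    and U: "U = exp (- (rho * (rho - t) / (8 * eps)))" "4 * U \<le> rho - t" "4 * U \<le> bp - rho"
  shows "\<exists>y'. (x n, y') \<in> S \<and> \<bar>y n - y'\<bar> \<le> 2 * U"
proof -
  interpret entering_orbit lam eps h x y rho al by fact
  interpret g: slow_graph lam eps h "- 1" Kp ap bp \<phi> S by fact
  have Kpe: "0 \<le> Kp * eps" "0 \<le> K * eps" "K * eps + Kp * eps = (K + Kp) * eps"
    using g.K_nonneg eps_pos K(2) by (auto simp: algebra_simps)
  have "\<bar>x n + y n\<bar> \<le> K * eps"
    using n(2)[unfolded abs_le_iff] rho_pos by (intro K; linarith)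
  then have yn: "\<bar>y n - rho\<bar> \<le> K * eps + r0"
    using n(1) by (auto simp: abs_le_iff)
  have yn_le: "y n \<le> 3 / 2 * rho" using n(2)[unfolded abs_le_iff] by linarith
  have below: "y 0 < t" using entry al t by simp
  obtain m where m: "t \<le> y m" "y m < t + eps * h" "\<And>k. k < m \<Longrightarrow> y k < t"
    using first_passage[OF below] by metis
  have mn: "m \<le> n"
    using m(3)[of n] yn small t by (cases "n < m") (auto simp: abs_le_iff)
  have range: "t \<le> y k" "ap \<le> y k" "y k \<le> bp" "y k \<le> 3 / 2 * rho" "y k \<le> 5 / 2 * rho" "rho / 2 \<le> y k"
    if "m \<le> k" "k \<le> n" for k
    using y_mono[of m k] y_mono[of k n] that m(1) yn small t yn_le rho_pos by (auto simp: abs_le_iff)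
  define v where "v i = \<bar>x (m + i) - \<phi> (y (m + i))\<bar>" for i
  have "v (n - m) \<le> exp (- (rho / 2 * h) * real (n - m)) * v 0"
  proof (rule geometric_bound)
    fix i assume i: "i < n - m"
    define k where "k = m + i"
    have k: "m \<le> k" "k \<le> n" "m \<le> Suc k" "Suc k \<le> n" using i by (auto simp: k_def)
    note rk = range[OF k(1,2)]
    have "y k + eps * h \<le> bp" using range(3)[OF k(3,4)] by (simp add: y_Suc)
    then have "euler_iter lam eps h 1 (\<phi> (y k), y k) = (\<phi> (y (Suc k)), y (Suc k))"
      using g.invariant[of "y k"] rk by (simp add: y_Suc)
    then have "\<phi> (y (Suc k)) = \<phi> (y k) + h * ((\<phi> (y k))\<^sup>2 - (y k)\<^sup>2 + lam * eps)"
      unfolding euler_iter_1 by simp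
    then have eq: "x (Suc k) - \<phi> (y (Suc k)) = (x k - \<phi> (y k)) * (1 + h * (x k + \<phi> (y k)))"
      by (simp add: x_Suc algebra_simps power2_eq_square)
    have b: "x k \<le> - y k + K * eps" "\<phi> (y k) \<le> - y k + Kp * eps" "- y k - Kp * eps \<le> \<phi> (y k)"
      using K(1)[OF rk(6,5)] g.near[OF rk(2,3)] by (auto simp: abs_le_iff)
    have "x k + \<phi> (y k) \<le> - (rho / 2)" using b rk small Kpe by linarith
    then have "h * (x k + \<phi> (y k)) \<le> h * - (rho / 2)" using h_pos by (intro mult_left_mono) auto
    moreover have "- (20 * rho) \<le> x k + \<phi> (y k)"
      using x_ge[OF rk(5)] b rk small Kpe rho_pos by linarith
    then have "h * - (20 * rho) \<le> h * (x k + \<phi> (y k))" using h_pos by (intro mult_left_mono) auto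
    ultimately have "\<bar>1 + h * (x k + \<phi> (y k))\<bar> \<le> 1 + - (rho / 2 * h)"
      using h_small by (simp add: algebra_simps)
    then have "\<bar>1 + h * (x k + \<phi> (y k))\<bar> * v i \<le> (1 + - (rho / 2 * h)) * v i"
      by (intro mult_right_mono) (auto simp: v_def)
    moreover have "v (Suc i) = \<bar>1 + h * (x k + \<phi> (y k))\<bar> * v i"
      using eq by (simp add: v_def k_def abs_mult)
    ultimately show "v (Suc i) \<le> (1 + - (rho / 2 * h)) * v i" by simp
  qed (simp add: v_def)
  also have "\<dots> \<le> exp (- (rho * (rho - t) / (8 * eps))) * 1"
  proof (intro mult_mono)
    have "(rho - t) / 4 / eps \<le> h * real (n - m)"
      unfolding time_eq[OF mn] using m(2) yn small eps_pos by (intro divide_right_mono) (auto simp: abs_le_iff)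
    then have "rho / 2 * ((rho - t) / 4 / eps) \<le> rho / 2 * (h * real (n - m))"
      using rho_pos by (intro mult_left_mono) auto
    then show "exp (- (rho / 2 * h) * real (n - m)) \<le> exp (- (rho * (rho - t) / (8 * eps)))"
      by (simp add: mult.assoc)
    show "v 0 \<le> 1"
      using K(1)[of m] range[of m] mn g.near[of "y m"] small Kpe by (auto simp: v_def abs_le_iff)
  qed (auto simp: v_def)
  finally have u: "\<bar>x n - \<phi> (y n)\<bar> \<le> U" using mn by (simp add: v_def U)
  have U0: "0 \<le> U" by (simp add: U)
  have rng: "ap \<le> y n - 2 * U" "y n + 2 * U \<le> bp"
    using yn small U t by (auto simp: abs_le_iff)
  have KU: "Kp * eps * (2 * U) \<le> 1 / 2 * (2 * U)" using small U0 by (intro mult_right_mono) auto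
  have "\<exists>y'\<ge>y n - 2 * U. y' \<le> y n + 2 * U \<and> \<phi> y' = x n"
  proof (rule IVT2')
    show "\<phi> (y n + 2 * U) \<le> x n"
      using g.slope[of "y n" "y n + 2 * U"] rng U0 u KU by (auto simp: abs_le_iff)
    show "x n \<le> \<phi> (y n - 2 * U)"
      using g.slope[of "y n - 2 * U" "y n"] rng U0 u KU by (auto simp: abs_le_iff)
    show "continuous_on {y n - 2 * U..y n + 2 * U} \<phi>"
      using rng by (intro continuous_on_subset[OF g.continuous_graph]) auto
  qed (use U0 in simp)
  then obtain y' where y': "y n - 2 * U \<le> y'" "y' \<le> y n + 2 * U" "\<phi> y' = x n" by blast
  have "(x n, y') \<in> S" using y' rng unfolding g.S_eq by (auto intro!: image_eqI[of _ _ y'])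
  then show ?thesis using y' by (intro exI[of _ y']) (auto simp: abs_le_iff)
qed

lemma transition_to_attracting_branch:
  fixes lam rho :: real
  assumes lam: "lam < 1" and rho: "0 < rho"
    and J: "open J" "0 \<in> J" "J \<subseteq> {- (rho / 4)<..<rho / 4}"
    and am: "0 < am" "am < rho" "rho < bm" and Sm: "slow_manifold lam attracting_branch_minus {- bm..- am} Sm"
    and ap: "0 < ap" "ap < rho" "rho < bp" and Sp: "slow_manifold lam attracting_branch_plus {ap..bp} Sp"
  shows "\<exists>eps0>0. \<exists>C>0. \<exists>K1 K2. \<forall>eps h c.
    0 \<le> eps \<and> eps \<le> eps0 \<and> 0 < h \<and> 0 < h * rho ^ 3 \<and> h * rho ^ 3 < eps \<and> 0 < c \<and> c < rho * h \<longrightarrow>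
      (\<exists>p. Delta_in rho J \<inter> forward_extension lam eps h (Sm eps h) = {p}) \<and>
      set_about_of_y_width (Pi_a lam eps h rho J ` Delta_in rho J) (Sp eps h)
        (K1 * (1 - c) powr (C * rho / (h * eps))) \<and>
      (\<forall>q \<in> Pi_a lam eps h rho J ` Delta_in rho J. infdist q (Delta_a_out rho J) \<le> K2 * (h * eps))"
proof -
  obtain j1 where j1: "0 < j1" "ball 0 j1 \<subseteq> J" using J(1,2) openE by blast
  define j where "j = min j1 rho / 2"
  have j: "0 < j" "j \<le> rho / 2" using j1 rho by (auto simp: j_def)
  have jJ: "{- j..j} \<subseteq> J"
    using j1 rho by (auto simp: j_def dist_real_def intro!: subsetD[OF j1(2)])
  obtain e1 h1 Km where Km: "0 < e1" "0 < h1" "0 \<le> Km"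
    "\<And>eps h. 0 < eps \<Longrightarrow> eps \<le> e1 \<Longrightarrow> 0 < h \<Longrightarrow> h \<le> h1 \<Longrightarrow> \<exists>\<phi>. slow_graph lam eps h 1 Km (- bm) (- am) \<phi> (Sm eps h)"
    by (rule slow_manifold_graph[OF Sm, of 1]) (use am in \<open>auto simp: attracting_branch_minus_def\<close>)
  obtain e2 h2 Kp where Kp: "0 < e2" "0 < h2" "0 \<le> Kp"
    "\<And>eps h. 0 < eps \<Longrightarrow> eps \<le> e2 \<Longrightarrow> 0 < h \<Longrightarrow> h \<le> h2 \<Longrightarrow> \<exists>\<phi>. slow_graph lam eps h (- 1) Kp ap bp \<phi> (Sp eps h)"
    by (rule slow_manifold_graph[OF Sp, of "- 1"]) (use ap in \<open>auto simp: attracting_branch_plus_def\<close>)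
  define cc where "cc = \<bar>lam - 1\<bar> / (5 * rho)"
  define b where "b = min 1 (1 - lam)"
  define K where "K = 1 + 4 * \<bar>lam + 1\<bar> / (b * rho)"
  define K2 where "K2 = 6 * rho * K + \<bar>lam\<bar>"
  define t where "t = max ap (rho / 2)"
  have cc: "0 < cc" "5 * rho * cc = \<bar>lam - 1\<bar>" using lam rho by (auto simp: cc_def)
  have b: "0 < b" "b \<le> 1" "b \<le> 1 - lam" using lam by (auto simp: b_def)
  have K: "0 < K" using b rho by (simp add: K_def add_pos_nonneg)
  have K2: "0 \<le> K2" using K rho unfolding K2_def by (intro add_nonneg_nonneg mult_nonneg_nonneg) auto
  have t: "rho / 2 \<le> t" "ap \<le> t" "t < rho" using ap rho by (auto simp: t_def)
  have gaps: "0 < bm - rho" "0 < rho - am" "0 < bp - rho" "0 < rho - t" "am\<^sup>2 < ((rho + am) / 2)\<^sup>2" "0 < rho + am"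
    using am ap t by (auto intro!: power_strict_mono)
  have "((\<lambda>e. (am + e * (e / rho ^ 3))\<^sup>2 - lam * e) \<longlongrightarrow> (am + 0 * (0 / rho ^ 3))\<^sup>2 - lam * 0) (at_right 0)"
    using rho by (intro tendsto_intros) auto
  then have lim: "\<forall>\<^sub>F e in at_right 0. (am + e * (e / rho ^ 3))\<^sup>2 - lam * e < ((rho + am) / 2)\<^sup>2"
    using gaps(5) by (intro order_tendstoD(2)) auto
  have "\<forall>\<^sub>F e in at_right 0.
      (am + e * (e / rho ^ 3))\<^sup>2 - lam * e < ((rho + am) / 2)\<^sup>2 \<and>
      e \<le> e1 \<and> e \<le> e2 \<and> e / rho ^ 3 \<le> h1 \<and> e / rho ^ 3 \<le> h2 \<and>
      20 * (e / rho ^ 3) * rho \<le> 1 \<and> \<bar>lam\<bar> * e \<le> rho\<^sup>2 \<and>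
      exp (- (3 * (rho / 2)\<^sup>2 / (8 * e))) * (cc * e + 5 * rho) \<le> cc * e / 2 \<and>
      16 * lam * e \<le> 3 * (rho / 2)\<^sup>2 \<and> b * (e / rho ^ 3) \<le> cc / 2 \<and>
      exp (- (b * rho\<^sup>2 / (32 * e))) * (5 * rho) \<le> e \<and>
      e * (e / rho ^ 3) \<le> rho / 8 \<and> K * e < j / 2 \<and> e * (e / rho ^ 3) < j / 4 \<and>
      e * (e / rho ^ 3) \<le> (rho - t) / 4 \<and>
      K2 * (e * (e / rho ^ 3)) \<le> rho / 4 \<and>
      K * e + K2 * (e * (e / rho ^ 3)) \<le> (rho - t) / 2 \<and>
      K * e + K2 * (e * (e / rho ^ 3)) \<le> (bp - rho) / 2 \<and>
      (K + Kp) * e \<le> 1 \<and> (K + Kp) * e \<le> rho / 2 \<and> Kp * e \<le> 1 / 2 \<and>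
      4 * exp (- (rho * (rho - t) / (8 * e))) \<le> rho - t \<and>
      4 * exp (- (rho * (rho - t) / (8 * e))) \<le> bp - rho \<and>
      Km * e \<le> 1 / 2 \<and> 2 * (Km * e) < j \<and> 2 * (Km * e) \<le> bm - rho \<and>
      2 * (Km * e) \<le> rho - am \<and> e * (e / rho ^ 3) + Km * e \<le> (rho - am) / 2 \<and>
      (e / rho ^ 3) * (rho + am) \<le> 1" (is "eventually ?P _")
    using rho cc b K j gaps(1-4,6) Km(1,2) Kp(1,2) by (intro eventually_conj lim; real_asymp)
  then obtain d where d: "0 < d" and small: "\<forall>e>0. e < d \<longrightarrow> ?P e"
    unfolding eventually_at_right_field by blast
  have main: "(\<exists>p. Delta_in rho J \<inter> forward_extension lam eps h (Sm eps h) = {p}) \<and>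
      set_about_of_y_width (Pi_a lam eps h rho J ` Delta_in rho J) (Sp eps h)
        (2 * (1 - c) powr ((rho - t) / (16 * rho) * rho / (h * eps))) \<and>
      (\<forall>q \<in> Pi_a lam eps h rho J ` Delta_in rho J. infdist q (Delta_a_out rho J) \<le> K2 * (h * eps))"
    if asm: "eps \<le> d / 2" "0 < h" "h * rho ^ 3 < eps" "0 < c" "c < rho * h" for eps h c
  proof -
    have eps: "0 < eps" "eps < d" using asm d mult_pos_pos[OF asm(2) zero_less_power[OF rho, of 3]] by auto
    note s = small[rule_format, OF eps]
    have hle: "h \<le> eps / rho ^ 3" using asm rho by (simp add: field_simps)
    have ehle: "eps * h \<le> eps * (eps / rho ^ 3)" using hle eps by (intro mult_left_mono) auto
    have h: "20 * h * rho \<le> 1"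
    proof -
      have "20 * h * rho = h * (20 * rho)" by (simp only: mult_ac)
      also have "\<dots> \<le> eps / rho ^ 3 * (20 * rho)" using hle rho by (intro mult_right_mono) auto
      also have "\<dots> = 20 * (eps / rho ^ 3) * rho" by (simp only: mult_ac)
      finally show ?thesis using s by linarith
    qed
    have ehpos: "0 < eps * h" using eps asm by simp
    obtain \<phi>m where gm: "slow_graph lam eps h 1 Km (- bm) (- am) \<phi>m (Sm eps h)"
      using Km(4)[of eps h] s eps asm hle by auto
    obtain \<phi>p where gp: "slow_graph lam eps h (- 1) Kp ap bp \<phi>p (Sp eps h)"
      using Kp(4)[of eps h] s eps asm hle by auto
    have unique: "\<exists>p. Delta_in rho J \<inter> forward_extension lam eps h (Sm eps h) = {p}"
    proof (rule unique_entry[OF gm am J(3)])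
      show "{- j<..<j} \<subseteq> J" using jJ by (auto simp: subset_iff)
      have "(am + eps * h)\<^sup>2 \<le> (am + eps * (eps / rho ^ 3))\<^sup>2"
        using ehle ehpos am by (intro power_mono) auto
      then show "(am + eps * h)\<^sup>2 \<le> ((rho + am) / 2)\<^sup>2 + lam * eps" using s by linarith
      have "h * (rho + am) \<le> eps / rho ^ 3 * (rho + am)"
        using hle gaps by (intro mult_right_mono) auto
      then show "h * (rho + am) \<le> 1" using s by linarith
    qed (use s j ehle in linarith)+
    have key: "\<exists>y'. (fst q, y') \<in> Sp eps h \<and> \<bar>snd q - y'\<bar> \<le> 2 * exp (- (rho * (rho - t) / (8 * eps)))"
        "infdist q (Delta_a_out rho J) \<le> K2 * (h * eps)"
      if q: "q \<in> Pi_a lam eps h rho J ` Delta_in rho J" for q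
    proof -
      obtain p where p: "p \<in> Delta_in rho J" and qp: "q = transition_map lam eps h (Delta_a_out rho J) p"
        using q by (auto simp: Pi_a_def)
      have ne: "Delta_a_out rho J \<noteq> {}" using J(2) by (auto simp: Delta_a_out_def intro!: exI[of _ rho])
      have fst_D: "fst p' = - rho" if "p' \<in> Delta_a_out rho J" for p'
        using that by (auto simp: Delta_a_out_def)
      have snd_D: "\<bar>snd p' - rho\<bar> \<le> rho / 4" "snd p' \<le> 2 * rho" if "p' \<in> Delta_a_out rho J" for p'
      proof -
        have "snd p' - rho \<in> J" using that by (auto simp: Delta_a_out_def)
        then have "snd p' - rho \<in> {- (rho / 4)<..<rho / 4}" using J(3) by blast
        then have "- (rho / 4) < snd p' - rho" "snd p' - rho < rho / 4" by simp_all
        then show "\<bar>snd p' - rho\<bar> \<le> rho / 4" "snd p' \<le> 2 * rho"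
          using rho unfolding abs_le_iff by linarith+
      qed
      obtain n where n: "transition_map lam eps h (Delta_a_out rho J) p = euler_iter lam eps h n p"
        "\<And>m. infdist (euler_iter lam eps h n p) (Delta_a_out rho J) \<le> infdist (euler_iter lam eps h m p) (Delta_a_out rho J)"
        using transition_map_minimal[OF eps(1) asm(2) ne snd_D(2)] by metis
      then have qn: "q = euler_iter lam eps h n p" using qp by simp
      define x where "x i = fst (euler_iter lam eps h i p)" for i
      define y where "y i = snd (euler_iter lam eps h i p)" for i
      have orb: "entering_orbit lam eps h x y rho (rho / 2)"
        unfolding x_def[abs_def] y_def[abs_def]
        using eps asm h s rho by (intro entering_orbit_of_section[OF _ _ _ _ _ _ J(3) p]) auto
      interpret entering_orbit lam eps h x y rho "rho / 2" by (rule orb)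
      have sep: "cc / 2 * eps \<le> y k - x k" if "- (rho / 2) / 2 \<le> y k" "y k \<le> 5 / 2 * rho" for k
        using signed_diff_ge[of cc k] that cc s lam by (simp add: sgn_if)
      have left: "b * y k \<le> y k - x k" if "0 \<le> y k" "y k \<le> 5 / 2 * rho" for k
      proof (rule left_of_ray[OF sep b(1,3,2) _ that])
        show "b * h \<le> cc / 2" using mult_left_mono[OF hle, of b] b s by linarith
      qed auto
      have ray: "\<bar>x k + y k\<bar> \<le> K * eps" if "rho / 2 \<le> y k" "y k \<le> 5 / 2 * rho" for k
        unfolding K_def by (rule sum_small[OF left b(1,2) _ _ that]) (use s ehle in linarith)+
      have Ks: "K * eps < j / 2" "eps * h < j / 4" using s ehle by linarith+
      obtain N where N: "rho - j \<le> y N" "y N < rho + j" "\<bar>x N + rho\<bar> \<le> (6 * rho * K + \<bar>lam\<bar>) * (h * eps)"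
        by (rule crossing_left[OF ray less_imp_le[OF K] j Ks]) (blast+)
      have "(- rho, y N) \<in> Delta_a_out rho J"
        using N jJ by (auto simp: Delta_a_out_def subset_iff)
      then have "infdist (euler_iter lam eps h N p) (Delta_a_out rho J) \<le> dist (euler_iter lam eps h N p) (- rho, y N)"
        by (rule infdist_le)
      also have "\<dots> = \<bar>x N + rho\<bar>"
        by (simp add: x_def y_def dist_prod_def dist_real_def)
      finally have inf: "infdist q (Delta_a_out rho J) \<le> K2 * (h * eps)"
        using n(2)[of N] N(3) unfolding qn K2_def by linarith
      then show "infdist q (Delta_a_out rho J) \<le> K2 * (h * eps)" .
      have "K2 * (eps * h) \<le> K2 * (eps * (eps / rho ^ 3))"
        by (rule mult_left_mono[OF ehle K2])
      then have r0: "K2 * (h * eps) \<le> K2 * (eps * (eps / rho ^ 3))" by (simp add: mult_ac)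
      have "\<bar>snd q - rho\<bar> - rho / 4 \<le> infdist q (Delta_a_out rho J)"
      proof (rule le_infdist[OF ne])
        show "\<bar>snd q - rho\<bar> - rho / 4 \<le> dist q p'" if "p' \<in> Delta_a_out rho J" for p'
          using snd_D(1)[OF that] dist_snd_le[of q p'] unfolding dist_real_def by linarith
      qed
      then have yn: "\<bar>y n - rho\<bar> \<le> rho / 2" using inf r0 s unfolding y_def qn by linarith
      have xn: "\<bar>x n + rho\<bar> \<le> K2 * (h * eps)"
        using fst_diff_le_infdist[OF ne fst_D, of q] inf by (simp add: x_def qn)
      have "\<exists>y'. (x n, y') \<in> Sp eps h \<and> \<bar>y n - y'\<bar> \<le> 2 * exp (- (rho * (rho - t) / (8 * eps)))"
        by (rule attracted_to_slow_graph[OF orb gp t ap(3) ray _ xn yn _ _ _ _ _ _ refl]; use s r0 ehle K in linarith)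
      then show "\<exists>y'. (fst q, y') \<in> Sp eps h \<and> \<bar>snd q - y'\<bar> \<le> 2 * exp (- (rho * (rho - t) / (8 * eps)))"
        by (simp add: qn x_def y_def)
    qed
    have "exp (- (2 * ((rho - t) / (16 * rho)) * rho\<^sup>2 / eps)) \<le> (1 - c) powr ((rho - t) / (16 * rho) * rho / (h * eps))"
      using asm eps rho gaps h by (intro powr_ge_exp) (auto simp: mult_ac)
    moreover have "2 * ((rho - t) / (16 * rho)) * rho\<^sup>2 / eps = rho * (rho - t) / (8 * eps)"
      using rho eps by (simp add: power2_eq_square field_simps)
    ultimately have U: "2 * exp (- (rho * (rho - t) / (8 * eps))) \<le> 2 * (1 - c) powr ((rho - t) / (16 * rho) * rho / (h * eps))"
      by simp
    have "set_about_of_y_width (Pi_a lam eps h rho J ` Delta_in rho J) (Sp eps h)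
        (2 * (1 - c) powr ((rho - t) / (16 * rho) * rho / (h * eps)))"
      unfolding set_about_of_y_width_def
    proof (rule ballI)
      fix q assume "q \<in> Pi_a lam eps h rho J ` Delta_in rho J"
      from key(1)[OF this] obtain y' where y': "(fst q, y') \<in> Sp eps h"
        "\<bar>snd q - y'\<bar> \<le> 2 * exp (- (rho * (rho - t) / (8 * eps)))" by blast
      from y'(2) U have "\<bar>snd q - y'\<bar> \<le> 2 * (1 - c) powr ((rho - t) / (16 * rho) * rho / (h * eps))"
        by (rule order_trans)
      with y'(1) show "case q of (x, y) \<Rightarrow> \<exists>y'. (x, y') \<in> Sp eps h \<and>
          \<bar>y - y'\<bar> \<le> 2 * (1 - c) powr ((rho - t) / (16 * rho) * rho / (h * eps))"
        by (cases q) auto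
    qed
    with unique show ?thesis using key(2) by blast
  qed
  show ?thesis
    by (rule exI[of _ "d / 2"], rule conjI, use d in simp, rule exI[of _ "(rho - t) / (16 * rho)"],
        rule conjI, use gaps rho in simp, rule exI[of _ 2], rule exI[of _ K2]) (use main in blast)
qed

section \<open>Passage for \<open>lam > 1\<close>\<close>

text \<open>Orbits have \<open>x < 0\<close> up to height \<open>- z\<close> and \<open>x > 3 * rho\<close> from height \<open>W\<close> on, so that
  everything near the exit happens at heights between \<open>- z\<close> and \<open>W\<close>. This window is shorter than
  \<open>gap\<close>, so it is the image of a piece of the slow manifold under a single iterate.\<close>

locale exit_regime = slow_graph lam eps h 1 K "- bm" "- am" \<phi> S
  for lam eps h K am bm :: real and \<phi> :: "real \<Rightarrow> real" and S :: "(real \<times> real) set" +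
  fixes rho al c z W gap :: real
  assumes lam: "1 < lam"
    and al: "0 < al" "al \<le> rho / 2" "al \<le> am" "am < rho" "rho < bm"
    and h_small: "20 * h * rho \<le> 1" and lam_small: "lam * eps \<le> rho\<^sup>2"
    and c: "0 < c" "5 * rho * (2 * c) \<le> lam - 1"
    and sep_small: "exp (- (3 * al\<^sup>2 / (8 * eps))) * (2 * c * eps + 5 * rho) \<le> c * eps"
    and eps_small: "256 * lam * eps \<le> 3 * al\<^sup>2" "(K + 8 * K / al) * eps \<le> c * al / 4" "K * eps \<le> al / 2"
    and z: "0 < z" "4 * lam * eps \<le> 3 * z\<^sup>2"
    and W: "eps * h + 4 * eps / sqrt ((lam - 1) * eps) \<le> W" "sqrt ((lam - 1) * eps) \<le> rho"
    and gap: "gap \<le> al / 8" "3 * gap \<le> rho - am" "eps * h \<le> gap" "z + W \<le> gap"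
begin

lemma gap_pos: "0 < gap" "0 < W" "z < gap" "W < gap" "z \<le> al / 8" "W \<le> al / 8"
proof -
  have "0 < eps * h + 4 * eps / sqrt ((lam - 1) * eps)"
    using lam eps_pos step_pos by (intro add_pos_nonneg) auto
  then show "0 < W" using W by simp
  then show "0 < gap" "z < gap" "W < gap" "z \<le> al / 8" "W \<le> al / 8" using z gap by auto
qed

lemma entering_graph:
  assumes "- rho \<le> w" "w \<le> - am"
  shows "entering_orbit lam eps h (\<lambda>n. fst (euler_iter lam eps h n (\<phi> w, w)))
    (\<lambda>n. snd (euler_iter lam eps h n (\<phi> w, w))) rho al"
proof -
  interpret euler_orbit lam eps h "\<lambda>n. fst (euler_iter lam eps h n (\<phi> w, w))"
      "\<lambda>n. snd (euler_iter lam eps h n (\<phi> w, w))"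
    using eps_pos h_pos by (rule euler_orbit_iter)
  have "\<bar>\<phi> w - 1 * w\<bar> \<le> al / 2"
    using near[of w] assms al eps_small by linarith
  then have "\<phi> w \<le> w + al / 2" "w - al / 2 \<le> \<phi> w"
    unfolding abs_le_iff by linarith+
  then show ?thesis
    using assms al h_small lam_small lam eps_pos by unfold_locales auto
qed

lemma separated:
  assumes "entering_orbit lam eps h x y rho al" "- al / 2 \<le> y n" "y n \<le> 5 / 2 * rho"
  shows "c * eps \<le> x n - y n"
proof -
  interpret entering_orbit lam eps h x y rho al by fact
  have "16 * lam * eps \<le> 3 * al\<^sup>2"
    using eps_small(1) mult_pos_pos[of lam eps] lam eps_pos by linarith
  then show ?thesis
    using signed_diff_ge[of "2 * c" n] c sep_small assms lam by (simp add: sgn_if)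
qed

lemma left_before:
  assumes "entering_orbit lam eps h x y rho al" "y n \<le> - z"
  shows "x n \<le> y n / 2" "x n < 0"
proof -
  interpret entering_orbit lam eps h x y rho al by fact
  show "x n \<le> y n / 2" using x_le[of z n] z assms(2) by simp
  then show "x n < 0" using assms(2) z by simp
qed

lemma escaped:
  assumes "entering_orbit lam eps h x y rho al" "W \<le> y n"
  shows "3 * rho \<le> x n - y n"
proof -
  interpret o: entering_orbit lam eps h x y rho al by fact
  show ?thesis
  proof (rule o.escapes)
    show "0 < sqrt ((lam - 1) * eps)" "(sqrt ((lam - 1) * eps))\<^sup>2 = (lam - 1) * eps"
      using lam eps_pos by auto
    show "0 \<le> x n - y n" if "- al / 2 \<le> y n" "y n \<le> 5 / 2 * rho" for n
      using separated[OF assms(1) that] mult_pos_pos[OF c(1) eps_pos] by simp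
    show "eps * h \<le> rho" using gap al by simp
  qed (use W assms in auto)
qed

lemma window:
  assumes "- am \<le> hi" "hi - lo + eps * h \<le> rho - am"
  obtains N where "- rho \<le> lo - real N * (eps * h)" "hi - real N * (eps * h) \<le> - am"
proof -
  define N where "N = nat \<lceil>(hi + am) / (eps * h)\<rceil>"
  have "0 \<le> (hi + am) / (eps * h)" using assms step_pos by simp
  then have "real N = of_int \<lceil>(hi + am) / (eps * h)\<rceil>"
    by (simp add: N_def)
  then have "(hi + am) / (eps * h) \<le> real N" "real N - 1 < (hi + am) / (eps * h)"
    using ceiling_correct[of "(hi + am) / (eps * h)"] by linarith+
  then have "hi + am \<le> real N * (eps * h)" "real N * (eps * h) < hi + am + eps * h"
    unfolding pos_divide_le_eq[OF step_pos] pos_less_divide_eq[OF step_pos] left_diff_distrib by simp_all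
  then show ?thesis using that[of N] assms(2) by simp
qed

lemma ext_spread:
  assumes y: "- al / 4 \<le> y1" "y1 \<le> y2" "y2 - y1 \<le> gap" "y2 \<le> 5 / 2 * rho"
    and N: "- rho \<le> y1 - real N * (eps * h)" "y2 - real N * (eps * h) \<le> - am"
  shows "y2 - y1 \<le> ext N y2 - ext N y1"
proof (cases "y1 = y2")
  case False
  define w1 w2 where "w1 = y1 - real N * (eps * h)" and "w2 = y2 - real N * (eps * h)"
  have w: "- rho \<le> w1" "w1 \<le> - am" "- rho \<le> w2" "w2 \<le> - am" "w1 \<le> w2" "w2 - w1 = y2 - y1"
    using y N by (auto simp: w1_def w2_def)
  have "y2 - y1 \<le> fst (euler_iter lam eps h N (\<phi> w2, w2)) - fst (euler_iter lam eps h N (\<phi> w1, w1))"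
  proof (rule orbits_spread[OF entering_graph entering_graph, where K = K and c = c])
    show "- K * eps \<le> fst (euler_iter lam eps h 0 (\<phi> w1, w1)) - snd (euler_iter lam eps h 0 (\<phi> w1, w1))"
      "- K * eps \<le> fst (euler_iter lam eps h 0 (\<phi> w2, w2)) - snd (euler_iter lam eps h 0 (\<phi> w2, w2))"
      using near[of w1] near[of w2] w al by (auto simp: abs_le_iff)
    show "- K * eps * (y2 - y1) \<le> fst (euler_iter lam eps h 0 (\<phi> w2, w2)) -
        fst (euler_iter lam eps h 0 (\<phi> w1, w1)) - (y2 - y1)"
      using slope[of w1 w2] w al by (simp add: abs_le_iff)
    show "c * eps \<le> fst (euler_iter lam eps h n (\<phi> w1, w1)) - snd (euler_iter lam eps h n (\<phi> w1, w1))"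
      if "- al / 2 \<le> snd (euler_iter lam eps h n (\<phi> w1, w1))"
        "snd (euler_iter lam eps h n (\<phi> w1, w1)) \<le> 5 / 2 * rho" for n
      using separated[OF entering_graph[OF w(1,2)] that] .
    show "c * eps \<le> fst (euler_iter lam eps h n (\<phi> w2, w2)) - snd (euler_iter lam eps h n (\<phi> w2, w2))"
      if "- al / 2 \<le> snd (euler_iter lam eps h n (\<phi> w2, w2))"
        "snd (euler_iter lam eps h n (\<phi> w2, w2)) \<le> 5 / 2 * rho" for n
      using separated[OF entering_graph[OF w(3,4)] that] .
  qed (use w y False lam eps_small K_nonneg c gap in \<open>auto simp: snd_euler_iter w1_def w2_def\<close>)
  then show ?thesis by (simp add: ext_def w1_def w2_def)
qed simp

lemma unique_exit:
  assumes J: "{- gap..gap} \<subseteq> J"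
  obtains k where "forward_extension lam eps h S \<inter> Delta_e_out rho J = {(rho, k)}" "\<bar>k\<bar> \<le> z + W"
proof -
  have "W - - z + eps * h \<le> rho - am" using gap gap_pos by simp
  then obtain N where N: "- rho \<le> - z - real N * (eps * h)" "W - real N * (eps * h) \<le> - am"
    using window[of W "- z"] gap_pos al by auto
  have win: "- rho \<le> y - real N * (eps * h)" "- bm \<le> y - real N * (eps * h)" "y - real N * (eps * h) \<le> - am"
    if "- z \<le> y" "y \<le> W" for y
    using that N al by auto
  have ent: "entering_orbit lam eps h (\<lambda>n. fst (euler_iter lam eps h n (\<phi> (y - real N * (eps * h)), y - real N * (eps * h))))
      (\<lambda>n. snd (euler_iter lam eps h n (\<phi> (y - real N * (eps * h)), y - real N * (eps * h)))) rho al"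
    if "- z \<le> y" "y \<le> W" for y
    using win[OF that] by (intro entering_graph)
  have ends: "- z \<le> - z" "- z \<le> W" "W \<le> W" using z gap_pos by auto
  have "\<exists>k\<ge>- z. k \<le> W \<and> ext N k = rho"
  proof (rule IVT')
    have "ext N (- z) < 0"
      using left_before(2)[OF ent[OF ends(1,2)], of N] by (simp add: ext_def snd_euler_iter)
    then show "ext N (- z) \<le> rho" using al by simp
    have "3 * rho \<le> ext N W - W"
      using escaped[OF ent[OF ends(2,3)], of N] by (simp add: ext_def snd_euler_iter)
    then show "rho \<le> ext N W" using gap_pos al by simp
    show "continuous_on {- z..W} (ext N)" using win by (intro continuous_ext) auto
  qed (use ends in simp)
  then obtain k where k: "- z \<le> k" "k \<le> W" "ext N k = rho" by blast
  have "(rho, k) \<in> forward_extension lam eps h S"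
    using ext_in_extension[of k N] win[OF k(1,2)] k(3) by simp
  moreover have "(rho, k) \<in> Delta_e_out rho J"
    using k J gap_pos by (auto simp: Delta_e_out_def intro!: subsetD[OF J])
  moreover have "q = (rho, k)" if q: "q \<in> forward_extension lam eps h S" "q \<in> Delta_e_out rho J" for q
  proof -
    obtain y where qy: "q = (rho, y)" using q(2) by (auto simp: Delta_e_out_def)
    consider "y \<le> - am" "rho = \<phi> y" "- bm \<le> y"
      | w m where "- am - eps * h < w" "w \<le> - am" "q = euler_iter lam eps h m (\<phi> w, w)"
      using extension_cases[OF q(1)] al qy by fastforce
    then have y: "- z < y \<and> y < W"
    proof cases
      case 1
      then show ?thesis using near[of y] eps_small(3) al by (simp add: abs_le_iff)
    next
      case 2
      have "- rho \<le> w" using 2 gap gap_pos by simp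
      note e = entering_graph[OF this 2(2)]
      have q': "fst (euler_iter lam eps h m (\<phi> w, w)) = rho" "snd (euler_iter lam eps h m (\<phi> w, w)) = y"
        using 2(3) qy by (metis fst_conv, metis snd_conv)
      show ?thesis
        using left_before(2)[OF e, of m] escaped[OF e, of m] al gap_pos unfolding q' by force
    qed
    then have yk: "- z \<le> y" "y \<le> W" by auto
    have "- am < y" using y gap_pos al by simp
    then have "rho = ext N y"
      using extension_eq_ext[of rho y N] q(1) qy win[OF yk] al by simp
    moreover have "k - y \<le> ext N k - ext N y" if "y \<le> k"
      by (rule ext_spread) (use that win(1)[OF yk] win(3)[OF k(1,2)] yk k(1,2) gap gap_pos al in linarith)+
    moreover have "y - k \<le> ext N y - ext N k" if "k \<le> y"
      by (rule ext_spread) (use that win(1)[OF k(1,2)] win(3)[OF yk] yk k(1,2) gap gap_pos al in linarith)+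
    ultimately have "y = k" using k(3) by linarith
    then show ?thesis using qy by simp
  qed
  ultimately have "forward_extension lam eps h S \<inter> Delta_e_out rho J = {(rho, k)}" by blast
  moreover have "\<bar>k\<bar> \<le> z + W" using k z gap_pos by (simp add: abs_le_iff)
  ultimately show ?thesis using that by blast
qed

lemma near_extension:
  assumes orb: "entering_orbit lam eps h x y rho al" and y0: "y 0 < - al"
    and n: "0 < x n" "x n \<le> 2 * rho"
    and U: "3 * rho * exp (5 * rho * (W + z) / eps - al\<^sup>2 / (8 * eps)) \<le> U" "U \<le> gap"
  shows "\<exists>y'. (x n, y') \<in> forward_extension lam eps h S \<and> \<bar>y n - y'\<bar> \<le> U"
proof -
  interpret o: entering_orbit lam eps h x y rho al by fact
  have rho: "0 < rho" using al by simp
  have "0 < 3 * rho * exp (5 * rho * (W + z) / eps - al\<^sup>2 / (8 * eps))"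
    using rho by (intro mult_pos_pos exp_gt_zero) simp_all
  then have U0: "0 < U" using U by linarith
  have yn: "- z < y n" "y n < W"
    using left_before(2)[OF orb, of n] escaped[OF orb, of n] n gap_pos rho by force+
  obtain N where N: "- rho \<le> y n - gap - real N * (eps * h)" "y n + gap - real N * (eps * h) \<le> - am"
    using window[of "y n + gap" "y n - gap"] yn gap gap_pos al by auto
  define w where "w = y n - real N * (eps * h)"
  have w: "- rho \<le> w" "w \<le> - am" "w + gap \<le> - am" using N gap_pos by (auto simp: w_def)
  define X where "X i = fst (euler_iter lam eps h i (\<phi> w, w))" for i
  define Y where "Y i = snd (euler_iter lam eps h i (\<phi> w, w))" for i
  have orb': "entering_orbit lam eps h X Y rho al"
    unfolding X_def[abs_def] Y_def[abs_def] by (rule entering_graph[OF w(1,2)])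
  interpret o': entering_orbit lam eps h X Y rho al by (rule orb')
  have YN: "Y N = y n" by (simp add: Y_def snd_euler_iter w_def)
  obtain m where m: "- al \<le> y m" "y m < - al + eps * h" "\<And>k. k < m \<Longrightarrow> y k < - al"
    using o.first_passage[OF y0] by metis
  have mn: "m \<le> n" using m(3)[of n] yn gap_pos al by (cases "n < m") auto
  have "real (n - m) * (eps * h) < real N * (eps * h)"
    using o.y_diff[OF mn] m(1) w gap_pos al by (simp add: w_def del: of_nat_diff)
  then have mN: "n - m < N" using step_pos by (simp add: mult_less_cancel_right del: of_nat_diff)
  define M where "M = N - (n - m)"
  have MN: "M + (n - m) = N" using mN by (simp add: M_def)
  have YM: "Y (M + i) = y (m + i)" for i
  proof -
    have "Y M = y m" using o'.y_eq[of M "n - m"] o.y_eq[of m "n - m"] MN YN mn by simp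
    then show ?thesis using o'.y_eq[of M i] o.y_eq[of m i] by simp
  qed
  have sep: "0 \<le> x i - y i" if "- al / 2 \<le> y i" "y i \<le> 5 / 2 * rho" for i
    using separated[OF orb that] mult_pos_pos[OF c(1) eps_pos] by simp
  define D where "D = 3 * rho * exp (5 * rho * (W + z) / eps - al\<^sup>2 / (8 * eps))"
  have "\<bar>x (m + (n - m)) - X (M + (n - m))\<bar> \<le> D"
  proof (rule exit_contraction[where x = "\<lambda>i. x (m + i)" and x' = "\<lambda>i. X (M + i)" and n = "n - m" and D = D and y = "\<lambda>i. y (m + i)" and al = al and z = z and rho = rho and Y = W])
    show "euler_orbit lam eps h (\<lambda>i. x (m + i)) (\<lambda>i. y (m + i))" by (rule o.shift)
    show "euler_orbit lam eps h (\<lambda>i. X (M + i)) (\<lambda>i. y (m + i))" using o'.shift[of M] by (simp add: YM)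
    show "- 3 * rho \<le> x (m + i) \<and> x (m + i) \<le> y (m + i) / 2" if "y (m + i) \<le> - z" for i
      using left_before(1)[OF orb that] o.x_ge[of "m + i"] that z rho by auto
    show "- 3 * rho \<le> X (M + i) \<and> X (M + i) \<le> y (m + i) / 2" if "y (m + i) \<le> - z" for i
      using left_before(1)[OF orb', of "M + i"] o'.x_ge[of "M + i"] that z rho by (auto simp: YM)
    show "\<bar>x (m + i)\<bar> \<le> 2 * rho" if "i < n - m" "- z \<le> y (m + i)" for i
    proof -
      have "y (m + i) \<le> y n" using that by (intro o.y_mono) auto
      then have "y (m + i) \<le> x (m + i)" "x (m + i) \<le> 2 * rho"
        using sep[of "m + i"] that gap_pos al yn n lam o.x_bounded_before[of "m + i" n] by auto
      then show ?thesis using that gap_pos al by simp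
    qed
    show "y (m + 0) < - al + eps * h" using m(2) by simp
    show "0 < al" "0 \<le> z" "z \<le> al / 2" "al \<le> rho" "eps * h \<le> al / 4" using z gap gap_pos al by auto
    show "20 * h * rho \<le> 1" by (rule h_small)
    show "- z \<le> y (m + (n - m))" "y (m + (n - m)) \<le> W" using yn mn by simp_all
    show "D = 3 * rho * exp (5 * rho * (W + z) / eps - al\<^sup>2 / (8 * eps))" by (rule D_def)
    show "D \<le> rho" using U gap al unfolding D_def by linarith
  qed
  then have u: "\<bar>x n - ext N (y n)\<bar> \<le> U"
    using mn MN U by (simp add: D_def X_def ext_def w_def)
  have "\<exists>y'\<ge>y n - U. y' \<le> y n + U \<and> ext N y' = x n"
  proof (rule IVT')
    show "ext N (y n - U) \<le> x n"
      using ext_spread[of "y n - U" "y n" N] u U U0 N yn gap gap_pos al by (auto simp: abs_le_iff)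
    show "x n \<le> ext N (y n + U)"
      using ext_spread[of "y n" "y n + U" N] u U U0 N yn gap gap_pos al by (auto simp: abs_le_iff)
    show "continuous_on {y n - U..y n + U} (ext N)"
      using N U al by (intro continuous_ext) auto
  qed (use U0 in simp)
  then obtain y' where y': "y n - U \<le> y'" "y' \<le> y n + U" "ext N y' = x n" by blast
  then have "(x n, y') \<in> forward_extension lam eps h S"
    using ext_in_extension[of y' N] N U al by auto
  then show ?thesis using y' by (intro exI[of _ y']) (auto simp: abs_le_iff)
qed

end

lemma transition_past_fold:
  fixes lam rho :: real
  assumes lam: "1 < lam" and rho: "0 < rho"
    and J: "open J" "0 \<in> J" "J \<subseteq> {- (rho / 4)<..<rho / 4}"
    and am: "0 < am" "am < rho" "rho < bm" and Sm: "slow_manifold lam attracting_branch_minus {- bm..- am} Sm"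
  shows "\<exists>eps0>0. \<exists>C>0. \<exists>K1 K2 K3. \<exists>k :: real \<Rightarrow> real \<Rightarrow> real. \<forall>eps h c.
    0 \<le> eps \<and> eps \<le> eps0 \<and> 0 < h \<and> 0 < h * rho ^ 3 \<and> h * rho ^ 3 < eps \<and> 0 < c \<and> c < rho * h \<longrightarrow>
      forward_extension lam eps h (Sm eps h) \<inter> Delta_e_out rho J = {(rho, k eps h)} \<and>
      \<bar>k eps h\<bar> \<le> K3 * eps powr (1 / 3) \<and>
      set_about_of_y_width (Pi_e lam eps h rho J ` Delta_in rho J)
        (forward_extension lam eps h (Sm eps h))
        (K1 * (1 - c) powr (C * rho / (h * eps))) \<and>
      (\<forall>q \<in> Pi_e lam eps h rho J ` Delta_in rho J.
        infdist q (Delta_e_out rho J) \<le> K2 * (h * (eps + rho ^ 2)))"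
proof -
  obtain j1 where j1: "0 < j1" "ball 0 j1 \<subseteq> J" using J(1,2) openE by blast
  obtain e1 h1 Km where Km: "0 < e1" "0 < h1" "0 \<le> Km"
    "\<And>eps h. 0 < eps \<Longrightarrow> eps \<le> e1 \<Longrightarrow> 0 < h \<Longrightarrow> h \<le> h1 \<Longrightarrow> \<exists>\<phi>. slow_graph lam eps h 1 Km (- bm) (- am) \<phi> (Sm eps h)"
    by (rule slow_manifold_graph[OF Sm, of 1]) (use am in \<open>auto simp: attracting_branch_minus_def\<close>)
  define al where "al = min am (rho / 2)"
  define gap where "gap = min (al / 8) (min ((rho - am) / 3) (j1 / 2))"
  define cc where "cc = (lam - 1) / (10 * rho)"
  define Z where "Z e = 2 * sqrt (lam * e)" for e
  define W where "W e = e * (e / rho ^ 3) + 4 * e / sqrt ((lam - 1) * e)" for e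
  have al: "0 < al" "al \<le> rho / 2" "al \<le> am" using am rho by (auto simp: al_def)
  have gap: "0 < gap" "gap \<le> al / 8" "3 * gap \<le> rho - am" "gap < j1"
    using al(1) am(2) j1(1) by (auto simp: gap_def min_def)
  have gapJ: "{- gap..gap} \<subseteq> J"
    using gap by (intro order_trans[OF _ j1(2)]) (auto simp: dist_real_def)
  have cc: "0 < cc" "5 * rho * (2 * cc) \<le> lam - 1" using lam rho by (auto simp: cc_def)
  define lm where "lm = lam - 1"
  have lm: "0 < lm" "0 < lam" using lam by (auto simp: lm_def)
  have "\<forall>\<^sub>F e in at_right 0. e \<le> e1 \<and> e / rho ^ 3 \<le> h1 \<and>
      20 * (e / rho ^ 3) * rho \<le> 1 \<and> lam * e \<le> rho\<^sup>2 \<and>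
      exp (- (3 * al\<^sup>2 / (8 * e))) * (2 * cc * e + 5 * rho) \<le> cc * e \<and>
      256 * lam * e \<le> 3 * al\<^sup>2 \<and> (Km + 8 * Km / al) * e \<le> cc * al / 4 \<and> Km * e \<le> al / 2 \<and>
      sqrt (lm * e) \<le> rho \<and> e * (e / rho ^ 3) \<le> gap \<and>
      2 * sqrt (lam * e) + (e * (e / rho ^ 3) + 4 * e / sqrt (lm * e)) + e * (e / rho ^ 3) \<le> gap \<and>
      2 * sqrt (lam * e) + (e * (e / rho ^ 3) + 4 * e / sqrt (lm * e)) \<le> e powr (1 / 3) \<and>
      e * ln (3 * rho) + 5 * rho * ((e * (e / rho ^ 3) + 4 * e / sqrt (lm * e)) + 2 * sqrt (lam * e)) \<le> al\<^sup>2 / 16 \<and>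
      exp (- (al\<^sup>2 / (16 * e))) \<le> gap \<and> (e / rho ^ 3) * (rho\<^sup>2 + lam * e) \<le> rho / 4"
    using rho al(1) gap(1) cc(1) Km(1-2) lm by (intro eventually_conj; real_asymp)
  then have "\<forall>\<^sub>F e in at_right 0. e \<le> e1 \<and> e / rho ^ 3 \<le> h1 \<and>
      20 * (e / rho ^ 3) * rho \<le> 1 \<and> lam * e \<le> rho\<^sup>2 \<and>
      exp (- (3 * al\<^sup>2 / (8 * e))) * (2 * cc * e + 5 * rho) \<le> cc * e \<and>
      256 * lam * e \<le> 3 * al\<^sup>2 \<and> (Km + 8 * Km / al) * e \<le> cc * al / 4 \<and> Km * e \<le> al / 2 \<and>
      sqrt ((lam - 1) * e) \<le> rho \<and> e * (e / rho ^ 3) \<le> gap \<and>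
      Z e + W e + e * (e / rho ^ 3) \<le> gap \<and> Z e + W e \<le> e powr (1 / 3) \<and>
      e * ln (3 * rho) + 5 * rho * (W e + Z e) \<le> al\<^sup>2 / 16 \<and>
      exp (- (al\<^sup>2 / (16 * e))) \<le> gap \<and> (e / rho ^ 3) * (rho\<^sup>2 + lam * e) \<le> rho / 4" (is "eventually ?P _")
    by (simp only: Z_def W_def lm_def)
  then obtain d where d: "0 < d" and small: "\<forall>e>0. e < d \<longrightarrow> ?P e"
    unfolding eventually_at_right_field by blast
  define k where "k eps h = (THE k. forward_extension lam eps h (Sm eps h) \<inter> Delta_e_out rho J = {(rho, k)})" for eps h
  define C where "C = al\<^sup>2 / (32 * rho\<^sup>2)"
  have C: "0 < C" using al rho by (simp add: C_def)
  have main: "forward_extension lam eps h (Sm eps h) \<inter> Delta_e_out rho J = {(rho, k eps h)} \<and>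
      \<bar>k eps h\<bar> \<le> 1 * eps powr (1 / 3) \<and>
      set_about_of_y_width (Pi_e lam eps h rho J ` Delta_in rho J)
        (forward_extension lam eps h (Sm eps h)) (1 * (1 - c) powr (C * rho / (h * eps))) \<and>
      (\<forall>q \<in> Pi_e lam eps h rho J ` Delta_in rho J.
        infdist q (Delta_e_out rho J) \<le> lam * (h * (eps + rho ^ 2)))"
    if asm: "eps \<le> d / 2" "0 < h" "h * rho ^ 3 < eps" "0 < c" "c < rho * h" for eps h c
  proof -
    have eps: "0 < eps" "eps < d" using asm d mult_pos_pos[OF asm(2) zero_less_power[OF rho, of 3]] by auto
    note s = small[rule_format, OF eps]
    have hle: "h \<le> eps / rho ^ 3" using asm rho by (simp add: field_simps)
    have ehle: "eps * h \<le> eps * (eps / rho ^ 3)" using hle eps by (intro mult_left_mono) auto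
    have h: "20 * h * rho \<le> 1"
    proof -
      have "20 * h * rho = h * (20 * rho)" by (simp only: mult_ac)
      also have "\<dots> \<le> eps / rho ^ 3 * (20 * rho)" using hle rho by (intro mult_right_mono) auto
      also have "\<dots> = 20 * (eps / rho ^ 3) * rho" by (simp only: mult_ac)
      finally show ?thesis using s by linarith
    qed
    have Z: "0 < Z eps" "4 * lam * eps \<le> 3 * (Z eps)\<^sup>2" using eps lm by (auto simp: Z_def power_mult_distrib)
    have W: "eps * h + 4 * eps / sqrt ((lam - 1) * eps) \<le> W eps" using ehle by (simp only: W_def)
    obtain \<phi> where "slow_graph lam eps h 1 Km (- bm) (- am) \<phi> (Sm eps h)"
      using Km(4)[of eps h] s eps asm hle by auto
    then interpret g: slow_graph lam eps h 1 Km "- bm" "- am" \<phi> "Sm eps h" .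
    have eh: "0 < eps * h" using eps asm by simp
    have ehgap: "eps * h \<le> gap" using s ehle by linarith
    have ZW: "Z eps + W eps \<le> gap" using s ehle eh by linarith
    interpret R: exit_regime lam eps h Km am bm \<phi> "Sm eps h" rho al cc "Z eps" "W eps" gap
    proof
      show "4 * lam * eps \<le> 3 * (Z eps)\<^sup>2" by (rule Z(2))
      show "exp (- (3 * al\<^sup>2 / (8 * eps))) * (2 * cc * eps + 5 * rho) \<le> cc * eps" using s by blast
      show "(Km + 8 * Km / al) * eps \<le> cc * al / 4" using s by blast
      show "sqrt ((lam - 1) * eps) \<le> rho" using s by blast
      show "eps * h + 4 * eps / sqrt ((lam - 1) * eps) \<le> W eps" by (rule W)
      show "lam * eps \<le> rho\<^sup>2" "256 * lam * eps \<le> 3 * al\<^sup>2" "Km * eps \<le> al / 2" using s by blast+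
    qed (fact lam al am h cc Z gap ZW ehgap)+
    obtain k0 where k0: "forward_extension lam eps h (Sm eps h) \<inter> Delta_e_out rho J = {(rho, k0)}" "\<bar>k0\<bar> \<le> Z eps + W eps"
      using R.unique_exit[OF gapJ] by blast
    have "k eps h = k0" unfolding k_def k0(1) by simp
    then have exit: "forward_extension lam eps h (Sm eps h) \<inter> Delta_e_out rho J = {(rho, k eps h)}"
        "\<bar>k eps h\<bar> \<le> 1 * eps powr (1 / 3)"
      using k0 s by auto
    have r0: "h * (rho\<^sup>2 + lam * eps) \<le> rho / 4"
    proof -
      have "h * (rho\<^sup>2 + lam * eps) \<le> eps / rho ^ 3 * (rho\<^sup>2 + lam * eps)"
        using hle lm eps by (intro mult_right_mono) auto
      then show ?thesis using s by linarith
    qed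
    have K2: "h * (rho\<^sup>2 + lam * eps) \<le> lam * (h * (eps + rho\<^sup>2))"
    proof -
      have "1 * (h * rho\<^sup>2) \<le> lam * (h * rho\<^sup>2)" using lam asm by (intro mult_right_mono) auto
      then show ?thesis by (simp add: algebra_simps)
    qed
    have D: "3 * rho * exp (5 * rho * (W eps + Z eps) / eps - al\<^sup>2 / (8 * eps)) \<le> exp (- (al\<^sup>2 / (16 * eps)))"
      "exp (- (al\<^sup>2 / (16 * eps))) \<le> gap"
    proof -
      have "eps * ln (3 * rho) + 5 * rho * (W eps + Z eps) \<le> al\<^sup>2 / 16" using s by blast
      then have "(eps * ln (3 * rho) + 5 * rho * (W eps + Z eps)) / eps \<le> al\<^sup>2 / 16 / eps"
        using eps by (intro divide_right_mono) auto
      then have "ln (3 * rho) + 5 * rho * (W eps + Z eps) / eps \<le> al\<^sup>2 / (16 * eps)"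
        using eps by (simp add: add_divide_distrib)
      moreover have "al\<^sup>2 / (8 * eps) = 2 * (al\<^sup>2 / (16 * eps))" by simp
      ultimately have "ln (3 * rho) + (5 * rho * (W eps + Z eps) / eps - al\<^sup>2 / (8 * eps)) \<le> - (al\<^sup>2 / (16 * eps))"
        by linarith
      then have "exp (ln (3 * rho) + (5 * rho * (W eps + Z eps) / eps - al\<^sup>2 / (8 * eps))) \<le> exp (- (al\<^sup>2 / (16 * eps)))"
        by (simp only: exp_le_cancel_iff)
      then show "3 * rho * exp (5 * rho * (W eps + Z eps) / eps - al\<^sup>2 / (8 * eps)) \<le> exp (- (al\<^sup>2 / (16 * eps)))"
        using rho by (simp add: exp_add)
      show "exp (- (al\<^sup>2 / (16 * eps))) \<le> gap" using s by blast
    qed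
    have key: "\<exists>y'. (fst q, y') \<in> forward_extension lam eps h (Sm eps h) \<and> \<bar>snd q - y'\<bar> \<le> exp (- (al\<^sup>2 / (16 * eps)))"
        "infdist q (Delta_e_out rho J) \<le> h * (rho\<^sup>2 + lam * eps)"
      if q: "q \<in> Pi_e lam eps h rho J ` Delta_in rho J" for q
    proof -
      obtain p where p: "p \<in> Delta_in rho J" and qp: "q = transition_map lam eps h (Delta_e_out rho J) p"
        using q by (auto simp: Pi_e_def)
      have ne: "Delta_e_out rho J \<noteq> {}" using J(2) by (auto simp: Delta_e_out_def)
      have fst_D: "fst p' = rho" if "p' \<in> Delta_e_out rho J" for p'
        using that by (auto simp: Delta_e_out_def)
      have snd_D: "snd p' \<le> rho / 4" if "p' \<in> Delta_e_out rho J" for p'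
      proof -
        have "snd p' \<in> J" using that by (auto simp: Delta_e_out_def)
        then have "snd p' \<in> {- (rho / 4)<..<rho / 4}" using J(3) by blast
        then show ?thesis by simp
      qed
      obtain n where n: "transition_map lam eps h (Delta_e_out rho J) p = euler_iter lam eps h n p"
        "\<And>m. infdist (euler_iter lam eps h n p) (Delta_e_out rho J) \<le> infdist (euler_iter lam eps h m p) (Delta_e_out rho J)"
        using transition_map_minimal[OF eps(1) asm(2) ne snd_D] by metis
      then have qn: "q = euler_iter lam eps h n p" using qp by simp
      define x where "x i = fst (euler_iter lam eps h i p)" for i
      define y where "y i = snd (euler_iter lam eps h i p)" for i
      have lam_rho: "\<bar>lam\<bar> * eps \<le> rho\<^sup>2" using s lm by simp
      have orb: "entering_orbit lam eps h x y rho al"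
        unfolding x_def[abs_def] y_def[abs_def]
        by (rule entering_orbit_of_section[OF eps(1) asm(2) h lam_rho al(1,2) J(3) p])
      have y0: "y 0 < - al"
      proof -
        have "snd p + rho \<in> J" using p by (auto simp: Delta_in_def)
        then have "snd p + rho \<in> {- (rho / 4)<..<rho / 4}" using J(3) by blast
        then have "snd p + rho < rho / 4" by simp
        then show ?thesis using al rho by (simp add: y_def)
      qed
      interpret o: entering_orbit lam eps h x y rho al by (rule orb)
      have sep: "0 \<le> x i - y i" if "- al / 2 \<le> y i" "y i \<le> 5 / 2 * rho" for i
        using R.separated[OF orb that] mult_pos_pos[OF cc(1) eps(1)] by simp
      have bounds: "0 \<le> lam" "lam * eps \<le> rho\<^sup>2" "0 \<le> Z eps" "Z eps + eps * h \<le> al / 2" "0 \<le> W eps" "W eps \<le> rho"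
        using lm lam_rho Z R.gap_pos gap ehgap al by auto
      obtain N where N: "- Z eps \<le> y N" "y N \<le> W eps + eps * h" "\<bar>x N - rho\<bar> \<le> h * (rho\<^sup>2 + lam * eps)"
        using o.crossing_right[OF bounds(1,2) sep bounds(3) Z(2) bounds(4) R.escaped[OF orb] bounds(5,6)] by blast
      have "- gap \<le> y N" "y N \<le> gap" using N R.gap_pos Z(1) s ehle by linarith+
      then have "(rho, y N) \<in> Delta_e_out rho J" using gapJ by (auto simp: Delta_e_out_def)
      then have "infdist (euler_iter lam eps h N p) (Delta_e_out rho J) \<le> dist (euler_iter lam eps h N p) (rho, y N)"
        by (rule infdist_le)
      also have "\<dots> = \<bar>x N - rho\<bar>"
        by (simp add: x_def y_def dist_prod_def dist_real_def)
      finally have inf: "infdist q (Delta_e_out rho J) \<le> h * (rho\<^sup>2 + lam * eps)"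
        using n(2)[of N] N(3) unfolding qn by linarith
      then show "infdist q (Delta_e_out rho J) \<le> h * (rho\<^sup>2 + lam * eps)" .
      have "\<bar>x n - rho\<bar> \<le> rho / 4"
        using fst_diff_le_infdist[OF ne fst_D, of q] inf r0 by (simp add: x_def qn)
      then have xn: "0 < x n" "x n \<le> 2 * rho" using rho unfolding abs_le_iff by linarith+
      from R.near_extension[OF orb y0 xn D]
      show "\<exists>y'. (fst q, y') \<in> forward_extension lam eps h (Sm eps h) \<and> \<bar>snd q - y'\<bar> \<le> exp (- (al\<^sup>2 / (16 * eps)))"
        by (simp add: qn x_def y_def)
    qed
    have "rho * h \<le> 1 / 2" using h by (simp add: mult_ac)
    then have "exp (- (2 * C * rho\<^sup>2 / eps)) \<le> (1 - c) powr (C * rho / (h * eps))"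
      by (rule powr_ge_exp[OF asm(4,5) _ less_imp_le[OF C] rho asm(2) eps(1)])
    moreover have "2 * C * rho\<^sup>2 / eps = al\<^sup>2 / (16 * eps)"
      using rho eps by (simp add: C_def field_simps)
    ultimately have U: "exp (- (al\<^sup>2 / (16 * eps))) \<le> 1 * (1 - c) powr (C * rho / (h * eps))"
      by simp
    have "set_about_of_y_width (Pi_e lam eps h rho J ` Delta_in rho J)
        (forward_extension lam eps h (Sm eps h)) (1 * (1 - c) powr (C * rho / (h * eps)))"
      unfolding set_about_of_y_width_def
    proof (rule ballI)
      fix q assume "q \<in> Pi_e lam eps h rho J ` Delta_in rho J"
      from key(1)[OF this] obtain y' where y': "(fst q, y') \<in> forward_extension lam eps h (Sm eps h)"
        "\<bar>snd q - y'\<bar> \<le> exp (- (al\<^sup>2 / (16 * eps)))" by blast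
      from y'(2) U have "\<bar>snd q - y'\<bar> \<le> 1 * (1 - c) powr (C * rho / (h * eps))"
        by (rule order_trans)
      with y'(1) show "case q of (x, y) \<Rightarrow> \<exists>y'. (x, y') \<in> forward_extension lam eps h (Sm eps h) \<and>
          \<bar>y - y'\<bar> \<le> 1 * (1 - c) powr (C * rho / (h * eps))"
        by (cases q) auto
    qed
    with exit show ?thesis using order_trans[OF key(2) K2] by blast
  qed
  show ?thesis
    by (rule exI[of _ "d / 2"], rule conjI, use d in simp, rule exI[of _ C],
        rule conjI, rule C, rule exI[of _ 1], rule exI[of _ lam], rule exI[of _ 1], rule exI[of _ k]) (use main in blast)
qed

theorem theorem3p1:
  fixes lam rho :: real
  assumes "lam \<noteq> 1" and "rho > 0"
  shows "\<exists>j0>0. \<forall>J :: real set. open J \<and> is_interval J \<and> 0 \<in> J \<and> J \<subseteq> {-j0<..<j0} \<longrightarrow>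
    (\<forall>am bm ap bp Sm Sp.
      0 < am \<and> am < rho \<and> rho < bm \<and> slow_manifold lam attracting_branch_minus {-bm..-am} Sm \<and>
      0 < ap \<and> ap < rho \<and> rho < bp \<and> slow_manifold lam attracting_branch_plus {ap..bp} Sp \<longrightarrow>
      (\<exists>eps0>0.
        (lam < 1 \<longrightarrow>
          (\<exists>C>0. \<exists>K1 K2. \<forall>eps h c.
            0 \<le> eps \<and> eps \<le> eps0 \<and> 0 < h \<and> 0 < h * rho ^ 3 \<and> h * rho ^ 3 < eps \<and> 0 < c \<and> c < rho * h \<longrightarrow>
              (\<exists>p. Delta_in rho J \<inter> forward_extension lam eps h (Sm eps h) = {p}) \<and>
              set_about_of_y_width (Pi_a lam eps h rho J ` Delta_in rho J) (Sp eps h)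
                (K1 * (1 - c) powr (C * rho / (h * eps))) \<and>
              (\<forall>q \<in> Pi_a lam eps h rho J ` Delta_in rho J.
                infdist q (Delta_a_out rho J) \<le> K2 * (h * eps)))) \<and>
        (lam > 1 \<longrightarrow>
          (\<exists>C>0. \<exists>K1 K2 K3. \<exists>k :: real \<Rightarrow> real \<Rightarrow> real. \<forall>eps h c.
            0 \<le> eps \<and> eps \<le> eps0 \<and> 0 < h \<and> 0 < h * rho ^ 3 \<and> h * rho ^ 3 < eps \<and> 0 < c \<and> c < rho * h \<longrightarrow>
              forward_extension lam eps h (Sm eps h) \<inter> Delta_e_out rho J = {(rho, k eps h)} \<and>
              \<bar>k eps h\<bar> \<le> K3 * eps powr (1 / 3) \<and>
              set_about_of_y_width (Pi_e lam eps h rho J ` Delta_in rho J)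
                (forward_extension lam eps h (Sm eps h))
                (K1 * (1 - c) powr (C * rho / (h * eps))) \<and>
              (\<forall>q \<in> Pi_e lam eps h rho J ` Delta_in rho J.
                infdist q (Delta_e_out rho J) \<le> K2 * (h * (eps + rho ^ 2)))))))"
    (is "\<exists>j0>0. \<forall>J. ?A j0 J \<longrightarrow> (\<forall>am bm ap bp Sm Sp. ?B am bm ap bp Sm Sp \<longrightarrow>
      (\<exists>eps0>0. (_ \<longrightarrow> ?L J Sm Sp eps0) \<and> (_ \<longrightarrow> ?R J Sm eps0)))")
proof (rule exI[of _ "rho / 4"], intro conjI allI impI)
  show "0 < rho / 4" using assms by simp
  fix J :: "real set" and am bm ap bp Sm Sp
  assume A: "?A (rho / 4) J" and B: "?B am bm ap bp Sm Sp"
  show "\<exists>eps0>0. (lam < 1 \<longrightarrow> ?L J Sm Sp eps0) \<and> (lam > 1 \<longrightarrow> ?R J Sm eps0)"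
  proof (cases "lam < 1")
    case True
    then have sign: "(lam < 1) = True" "(1 < lam) = False" by auto
    have "\<exists>eps0>0. ?L J Sm Sp eps0"
      by (rule transition_to_attracting_branch[where am = am and bm = bm and ap = ap and bp = bp])
        (use A B assms True in blast)+
    then show ?thesis by (simp only: sign simp_thms)
  next
    case False
    then have sign: "(lam < 1) = False" "(1 < lam) = True" using assms by auto
    have "\<exists>eps0>0. ?R J Sm eps0"
      by (rule transition_past_fold[where am = am and bm = bm]) (use A B assms sign in blast)+
    then show ?thesis by (simp only: sign simp_thms)
  qed
qed

end
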